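(* Let $U_{n,m}$ be a uni-cyclic graph (a finite simple connected graph on $n$ vertices containing exactly one cycle, which has length $m\le n$), let $\Delta_s(U_{n,m})$ be its spanning simplicial complex, let $K$ be a field, and let $(h_i)$ be the $h$-vector of the Stanley-Reisner ring $K[\Delta_s(U_{n,m})]$. Then $h_k=0$ for $k>n-1$ and $$h_k=\begin{cases}\displaystyle\sum_{i=0}^{k}(-1)^{k-i}\binom{n-1-i}{k-i}\binom{n}{i}, & \text{for } k\le m-1,\\[10pt] \displaystyle\sum_{i=0}^{k}(-1)^{k-i}\binom{n-1-i}{k-i}\left[\binom{n}{i}-\binom{n-m}{i-m}\right], & \text{for } m-1<k\le n-1.\end{cases}$$
   Context: A spanning tree of a finite simple connected graph $G(V,E)$ is a subtree of $G$ containing every vertex of $G$; $s(G)$ is the collection of all edge sets of spanning trees of $G$. The spanning simplicial complex $\Delta_s(G)$ is the simplicial complex on the vertex set $E$ (the edges of $G$) whose facets are precisely the elements of $s(G)$. A uni-cyclic graph $U_{n,m}$ has exactly $n$ edges. For a simplicial complex $\Delta$ on a vertex set of size $n$, the Stanley-Reisner ideal $I_{\mathcal N}(\Delta)\subset S=K[x_1,\ldots,x_n]$ (one variable per vertex) is generated by the monomials corresponding to non-faces of $\Delta$, and the Stanley-Reisner ring is the standard graded algebra $K[\Delta]=S/I_{\mathcal N}(\Delta)$. For a standard graded $K$-algebra $A$ of Krull dimension $d$, let $h(t)=h_0+h_1t+\cdots+h_rt^r$ be the unique polynomial with integer coefficients with $h(1)\ne 0$ such that the Hilbert series of $A$ equals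 $h(t)/(1-t)^d$; the $h$-vector of $A$ is $(h_0,\ldots,h_r)$, with $h_k$ understood as $0$ for $k>r$. Binomial coefficients $\binom{a}{b}$ with $b<0$ are $0$. *)

theory Defs
  imports
    "HOL-Library.Poly_Mapping"
    "HOL-Library.Extended_Nat"
    "HOL-Computational_Algebra.Polynomial_FPS"
    "HOL-Algebra.QuotRing"
    "HOL-Algebra.Embedded_Algebras"
begin

definition simple_graph :: "'v set \<Rightarrow> 'v set set \<Rightarrow> bool" where
  "simple_graph V E \<longleftrightarrow> finite V \<and> (\<forall>e\<in>E. e \<subseteq> V \<and> card e = 2)"

definition connected_graph :: "'v set \<Rightarrow> 'v set set \<Rightarrow> bool" where
  "connected_graph V E \<longleftrightarrow>
     V \<noteq> {} \<and> (\<forall>u\<in>V. \<forall>v\<in>V. (u, v) \<in> {(a, b). a \<in> V \<and> b \<in> V \<and> {a, b} \<in> E}\<^sup>*)"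

text \<open>A cycle is identified with its edge set, so that rotating or reversing the list of
  its vertices does not give a new cycle; its length is the number of its edges.\<close>

definition cycle_edges :: "'v list \<Rightarrow> 'v set set" where
  "cycle_edges vs = {{vs ! i, vs ! (Suc i mod length vs)} | i. i < length vs}"

definition graph_cycles :: "'v set set \<Rightarrow> 'v set set set" where
  "graph_cycles E =
     {cycle_edges vs | vs. distinct vs \<and> length vs \<ge> 3 \<and> cycle_edges vs \<subseteq> E}"

definition tree_graph :: "'v set \<Rightarrow> 'v set set \<Rightarrow> bool" where
  "tree_graph V E \<longleftrightarrow> simple_graph V E \<and> connected_graph V E \<and> graph_cycles E = {}"

definition unicyclic_graph :: "nat \<Rightarrow> nat \<Rightarrow> 'v set \<Rightarrow> 'v set set \<Rightarrow> bool" where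
  "unicyclic_graph n m V E \<longleftrightarrow>
     simple_graph V E \<and> connected_graph V E \<and> card V = n \<and>
     (\<exists>C. graph_cycles E = {C} \<and> card C = m)"

definition spanning_trees :: "'v set \<Rightarrow> 'v set set \<Rightarrow> 'v set set set" where
  "spanning_trees V E = {T. T \<subseteq> E \<and> tree_graph V T}"

text \<open>Spanning trees of a fixed graph all have the same number of edges, so no one contains
  another, and they are precisely the facets of the complex they generate.\<close>

definition spanning_complex :: "'v set \<Rightarrow> 'v set set \<Rightarrow> 'v set set set" where
  "spanning_complex V E = {F. \<exists>T\<in>spanning_trees V E. F \<subseteq> T}"

text \<open>Polynomials in variables indexed by \<^typ>\<open>'x\<close> are finitely supported functions from
  exponent vectors to coefficients, with the convolution product of \<^typ>\<open>'a \<Rightarrow>\<^sub>0 'b\<close>.\<close>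

type_synonym ('x, 'k) mvpoly = "('x \<Rightarrow>\<^sub>0 nat) \<Rightarrow>\<^sub>0 'k"

definition mvpoly_ring :: "'x set \<Rightarrow> ('x, 'k::field) mvpoly ring" where
  "mvpoly_ring X =
     \<lparr>carrier = {p. \<forall>t\<in>Poly_Mapping.keys p. Poly_Mapping.keys t \<subseteq> X},
      mult = (*), one = 1, zero = 0, add = (+)\<rparr>"

definition mvconst :: "'k \<Rightarrow> ('x, 'k::field) mvpoly" where
  "mvconst c = Poly_Mapping.single 0 c"

definition mvvar :: "'x \<Rightarrow> ('x, 'k::field) mvpoly" where
  "mvvar x = Poly_Mapping.single (Poly_Mapping.single x 1) 1"

definition homogeneous_polys :: "'x set \<Rightarrow> nat \<Rightarrow> ('x, 'k::field) mvpoly set" where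
  "homogeneous_polys X i =
     {p \<in> carrier (mvpoly_ring X).
        \<forall>t\<in>Poly_Mapping.keys p. (\<Sum>x\<in>Poly_Mapping.keys t. Poly_Mapping.lookup t x) = i}"

definition stanley_reisner_ideal :: "'x set \<Rightarrow> 'x set set \<Rightarrow> ('x, 'k::field) mvpoly set" where
  "stanley_reisner_ideal X \<Delta> =
     genideal (mvpoly_ring X) {(\<Prod>x\<in>F. mvvar x) | F. F \<subseteq> X \<and> F \<notin> \<Delta>}"

definition stanley_reisner_ring :: "'x set \<Rightarrow> 'x set set \<Rightarrow> ('x, 'k::field) mvpoly set ring" where
  "stanley_reisner_ring X \<Delta> = mvpoly_ring X Quot stanley_reisner_ideal X \<Delta>"

definition stanley_reisner_scalars :: "'x set \<Rightarrow> 'x set set \<Rightarrow> ('x, 'k::field) mvpoly set set" where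
  "stanley_reisner_scalars X \<Delta> =
     (\<lambda>c. stanley_reisner_ideal X \<Delta> +>\<^bsub>mvpoly_ring X\<^esub> mvconst c) ` UNIV"

definition stanley_reisner_component ::
    "'x set \<Rightarrow> 'x set set \<Rightarrow> nat \<Rightarrow> ('x, 'k::field) mvpoly set set" where
  "stanley_reisner_component X \<Delta> i =
     (\<lambda>p. stanley_reisner_ideal X \<Delta> +>\<^bsub>mvpoly_ring X\<^esub> p) ` homogeneous_polys X i"

text \<open>A graded algebra is given by a ring \<open>A\<close>, the subfield \<open>K\<close> of its scalars, and the family
  \<open>G\<close> of its homogeneous components.\<close>

definition krull_dim :: "('a, 'b) ring_scheme \<Rightarrow> enat" where
  "krull_dim A =
     Sup {enat r | r. \<exists>P. (\<forall>i\<le>r. primeideal (P i) A) \<and> (\<forall>i<r. P i \<subset> P (Suc i))}"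

definition hilbert_function ::
    "('a, 'b) ring_scheme \<Rightarrow> 'a set \<Rightarrow> (nat \<Rightarrow> 'a set) \<Rightarrow> nat \<Rightarrow> nat" where
  "hilbert_function A K G i = ring.dim A K (G i)"

definition hilbert_series ::
    "('a, 'b) ring_scheme \<Rightarrow> 'a set \<Rightarrow> (nat \<Rightarrow> 'a set) \<Rightarrow> int fps" where
  "hilbert_series A K G = Abs_fps (\<lambda>i. int (hilbert_function A K G i))"

definition h_polynomial ::
    "('a, 'b) ring_scheme \<Rightarrow> 'a set \<Rightarrow> (nat \<Rightarrow> 'a set) \<Rightarrow> int poly" where
  "h_polynomial A K G =
     (THE h. poly h 1 \<noteq> 0 \<and>
        (\<exists>d. krull_dim A = enat d \<and> hilbert_series A K G * (1 - fps_X) ^ d = fps_of_poly h))"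

definition h_vector ::
    "('a, 'b) ring_scheme \<Rightarrow> 'a set \<Rightarrow> (nat \<Rightarrow> 'a set) \<Rightarrow> nat \<Rightarrow> int" where
  "h_vector A K G k = Polynomial.coeff (h_polynomial A K G) k"

definition stanley_reisner_h_vector ::
    "'k::field itself \<Rightarrow> 'x set \<Rightarrow> 'x set set \<Rightarrow> nat \<Rightarrow> int" where
  "stanley_reisner_h_vector _ X \<Delta> =
     h_vector (stanley_reisner_ring X \<Delta> :: ('x, 'k) mvpoly set ring)
       (stanley_reisner_scalars X \<Delta>) (stanley_reisner_component X \<Delta>)"

text \<open>Natural-number subtraction would turn a negative lower index into \<open>0\<close>, and the
  coefficient into \<open>1\<close>; hence the integer lower index.\<close>

definition binom :: "nat \<Rightarrow> int \<Rightarrow> int" where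
  "binom a b = (if b < 0 then 0 else int (a choose nat b))"

end

theory Submission
  imports Defs
begin

text \<open>
  In a unicyclic graph with cycle \<open>C\<close>, deleting any edge of \<open>C\<close> leaves a spanning tree, so the
  faces of the spanning complex are the edge sets not containing \<open>C\<close>; since a tree on \<open>n\<close> vertices
  has \<open>n - 1\<close> edges, the graph has \<open>n\<close> edges and the face numbers are
  \<open>f i = (n choose i) - (n - m choose i - m)\<close>.

  For any complex, the Stanley-Reisner ideal is spanned by the monomials whose support is not a
  face, so the Hilbert function counts monomials supported on faces. The monomials with support
  exactly \<open>F\<close> contribute \<open>(X / (1 - X)) ^ card F\<close> to the Hilbert series; multiplying by
  \<open>(1 - X) ^ d\<close>, where \<open>d\<close> is the largest size of a face, gives the polynomial
  \<open>\<Sum>F. X ^ card F * (1 - X) ^ (d - card F)\<close>, which is nonzero at \<open>1\<close>.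

  It remains to see that \<open>d\<close> is the Krull dimension. The primes generated by the variables outside
  shrinking subsets of a face with \<open>d\<close> elements form a chain of length \<open>d\<close>. Conversely, elements
  \<open>a i\<close> of \<open>Q (Suc i) - Q i\<close> for a chain of \<open>d + 2\<close> primes would be \<open>d + 1\<close> algebraically
  independent elements, but the space of polynomials of degree at most \<open>N\<close> modulo the ideal has
  dimension of order \<open>N ^ d\<close>, which is too small for that.
\<close>

section \<open>Spanning trees of unicyclic graphs\<close>

text \<open>Names the adjacency relation that \<open>connected_graph\<close> writes out inline, so
  that its reflexive transitive closure can be handled by lemmas.\<close>

definition edge_rel :: "'v set \<Rightarrow> 'v set set \<Rightarrow> ('v \<times> 'v) set" where
  "edge_rel V E = {(a, b). a \<in> V \<and> b \<in> V \<and> {a, b} \<in> E}"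

lemma connected_graph_iff:
  "connected_graph V E \<longleftrightarrow> V \<noteq> {} \<and> (\<forall>u\<in>V. \<forall>v\<in>V. (u, v) \<in> (edge_rel V E)\<^sup>*)"
  unfolding connected_graph_def edge_rel_def ..

lemma edge_relI: "a \<in> V \<Longrightarrow> b \<in> V \<Longrightarrow> {a, b} \<in> E \<Longrightarrow> (a, b) \<in> edge_rel V E"
  by (simp add: edge_rel_def)

lemma edge_relD: "(a, b) \<in> edge_rel V E \<Longrightarrow> a \<in> V \<and> b \<in> V \<and> {a, b} \<in> E"
  by (simp add: edge_rel_def)

lemma edge_rel_mono: "E \<subseteq> E' \<Longrightarrow> edge_rel V E \<subseteq> edge_rel V E'"
  unfolding edge_rel_def by auto

lemma sym_edge_rel: "sym (edge_rel V E)"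
  by (rule symI) (simp add: edge_rel_def insert_commute)

lemma edge_rel_rtrancl_sym: "(a, b) \<in> (edge_rel V E)\<^sup>* \<Longrightarrow> (b, a) \<in> (edge_rel V E)\<^sup>*"
  using sym_edge_rel sym_rtrancl symD by metis

lemma graph_cycles_mono: "E \<subseteq> E' \<Longrightarrow> graph_cycles E \<subseteq> graph_cycles E'"
  unfolding graph_cycles_def by (rule subsetI) (elim CollectE exE conjE, intro CollectI exI conjI, auto)

text \<open>Extend the path along the walk; if the next vertex already lies on it, cut the path back
  to that vertex, so that no repetition ever arises.\<close>

lemma edge_rel_rtrancl_distinct_path:
  assumes "(u, v) \<in> (edge_rel V E)\<^sup>*"
  shows "\<exists>p. p \<noteq> [] \<and> distinct p \<and> hd p = u \<and> last p = v \<and> successively (\<lambda>a b. {a, b} \<in> E) p"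
  using assms
proof (induction rule: rtrancl_induct)
  case base
  show ?case by (rule exI[of _ "[u]"]) simp
next
  case (step y z)
  then obtain p where p: "p \<noteq> []" "distinct p" "hd p = u" "last p = y"
      "successively (\<lambda>a b. {a, b} \<in> E) p" by blast
  have yz: "{y, z} \<in> E" using edge_relD[OF step.hyps(2)] by simp
  show ?case
  proof (cases "z \<in> set p")
    case True
    then obtain xs ys where xy: "p = xs @ z # ys" by (meson split_list)
    have "successively (\<lambda>a b. {a, b} \<in> E) (xs @ [z])"
      using p(5) unfolding xy by (auto simp: successively_append_iff)
    moreover have "hd (xs @ [z]) = u" using p(3) xy by (cases xs) auto
    ultimately show ?thesis using p(2) xy by (intro exI[of _ "xs @ [z]"]) auto
  next
    case False
    then show ?thesis using p yz
      by (intro exI[of _ "p @ [z]"]) (auto simp: successively_append_iff)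
  qed
qed

text \<open>A simple path from \<open>u\<close> to \<open>v\<close> followed by the new edge is a
  cycle. The path has at least three vertices, as \<open>graph_cycles\<close> demands:
  \<open>u\<close> and \<open>v\<close> differ, which excludes one vertex, and are not adjacent in
  \<open>E\<close>, which excludes two.\<close>

lemma cycle_closing_path:
  assumes "(u, v) \<in> (edge_rel V E)\<^sup>*" "u \<noteq> v" "{u, v} \<notin> E"
  shows "graph_cycles (insert {u, v} E) \<noteq> {}"
proof -
  obtain p where p: "p \<noteq> []" "distinct p" "hd p = u" "last p = v"
      "successively (\<lambda>a b. {a, b} \<in> E) p"
    using edge_rel_rtrancl_distinct_path[OF assms(1)] by blast
  have adj: "{p ! i, p ! Suc i} \<in> E" if "Suc i < length p" for i
    using p(5) that by (simp add: successively_conv_nth)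
  have ends: "p ! 0 = u" "p ! (length p - 1) = v"
    using p by (simp_all add: hd_conv_nth last_conv_nth)
  have "length p \<noteq> 1" using ends assms(2) by auto
  moreover have "length p \<noteq> 2" using adj[of 0] ends assms(3) by auto
  moreover have "length p \<noteq> 0" using p(1) by simp
  ultimately have len: "length p \<ge> 3" by linarith
  have "{p ! i, p ! (Suc i mod length p)} \<in> insert {u, v} E" if i: "i < length p" for i
  proof (cases "Suc i < length p")
    case True
    then show ?thesis using adj[OF True] by simp
  next
    case False
    then have "Suc i = length p" using i by simp
    then have "p ! i = v" "p ! (Suc i mod length p) = u" using ends by (auto simp flip: \<open>Suc i = length p\<close>)
    then show ?thesis by (simp add: insert_commute)
  qed
  then have "cycle_edges p \<subseteq> insert {u, v} E"
    unfolding cycle_edges_def by blast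
  then have "cycle_edges p \<in> graph_cycles (insert {u, v} E)"
    unfolding graph_cycles_def using p(2) len by blast
  then show ?thesis by blast
qed

text \<open>The labelling \<open>f\<close> assigns to each vertex a representative of its component, so that
  \<open>card (f ` V)\<close> counts components.\<close>

lemma forest_component_labelling:
  fixes V :: "'v set"
  assumes "finite V" "finite F" "\<forall>e\<in>F. e \<subseteq> V \<and> card e = 2" "graph_cycles F = {}"
  shows "\<exists>f :: 'v \<Rightarrow> 'v. (\<forall>a b. {a, b} \<in> F \<longrightarrow> f a = f b) \<and>
      (\<forall>a\<in>V. \<forall>b\<in>V. f a = f b \<longrightarrow> (a, b) \<in> (edge_rel V F)\<^sup>*) \<and>
      card (f ` V) + card F = card V"
  using assms(2-)
proof (induction F rule: finite_induct)
  case empty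
  show ?case by (rule exI[of _ "\<lambda>x. x"]) simp
next
  case (insert e F)
  have "graph_cycles F = {}" using graph_cycles_mono[of F "insert e F"] insert.prems(2) by blast
  moreover have "\<forall>e\<in>F. e \<subseteq> V \<and> card e = 2" using insert.prems(1) by simp
  ultimately obtain f :: "'v \<Rightarrow> 'v" where f: "\<forall>a b. {a, b} \<in> F \<longrightarrow> f a = f b"
      "\<forall>a\<in>V. \<forall>b\<in>V. f a = f b \<longrightarrow> (a, b) \<in> (edge_rel V F)\<^sup>*"
      "card (f ` V) + card F = card V"
    using insert.IH by (elim meta_impE exE conjE) assumption+
  note f1 = f(1)[rule_format] and f2 = f(2)[rule_format] and f3 = f(3)
  have "card e = 2" using insert.prems(1) by simp
  then obtain u v where uv: "e = {u, v}" "u \<noteq> v"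
    by (auto simp only: card_2_iff)
  have V: "u \<in> V" "v \<in> V" using insert.prems(1) uv(1) by simp_all
  have ne: "f u \<noteq> f v"
    \<comment> \<open>Equal labels would join \<open>u\<close> to \<open>v\<close> inside
      \<open>F\<close>, and \<open>e\<close> would then close a cycle.\<close>
    using cycle_closing_path[OF f2[OF V] uv(2)] insert.prems(2) insert.hyps(2) uv by auto
  \<comment> \<open>The new edge merges the component of \<open>u\<close> into that of
    \<open>v\<close>: just the label \<open>f u\<close> disappears, which balances the additional
    edge.\<close>
  define g where "g = (\<lambda>a. if f a = f u then f v else f a)"
  let ?R = "(edge_rel V (insert e F))\<^sup>*"
  have g1: "g a = g b" if "{a, b} \<in> insert e F" for a b
  proof (cases "{a, b} \<in> F")
    case True
    then show ?thesis using f1[OF True] by (simp add: g_def)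
  next
    case False
    then have "{a, b} = {u, v}" using that uv by simp
    then show ?thesis by (auto simp: doubleton_eq_iff g_def)
  qed
  have up: "(a, b) \<in> ?R" if "a \<in> V" "b \<in> V" "f a = f b" for a b
    using f2[OF that] rtrancl_mono[OF edge_rel_mono[of F "insert e F" V]] by blast
  have uvR: "(u, v) \<in> ?R"
    by (rule r_into_rtrancl, rule edge_relI) (use V uv in auto)
  have vuR: "(v, u) \<in> ?R" using edge_rel_rtrancl_sym[OF uvR] .
  have g2: "(a, b) \<in> ?R" if ab: "a \<in> V" "b \<in> V" "g a = g b" for a b
  proof (cases "f a = f b")
    case True
    then show ?thesis using up ab by simp
  next
    case False
    then consider "f a = f u" "f b = f v" | "f a = f v" "f b = f u"
      using ab(3) unfolding g_def by (metis)
    then show ?thesis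
    proof cases
      case 1
      have "(a, u) \<in> ?R" "(v, b) \<in> ?R" using up 1 ab V by auto
      then show ?thesis using uvR by (meson rtrancl_trans)
    next
      case 2
      have "(a, v) \<in> ?R" "(u, b) \<in> ?R" using up 2 ab V by auto
      then show ?thesis using vuR by (meson rtrancl_trans)
    qed
  qed
  have "g ` V = f ` V - {f u}"
    using V ne by (auto simp: g_def image_iff)
  then have "card (g ` V) = card (f ` V) - 1" using V assms(1) by simp
  moreover have "card (f ` V) > 0" using V assms(1) by (auto simp: card_gt_0_iff)
  ultimately have "card (g ` V) + card (insert e F) = card V"
    using f3 insert.hyps by simp
  then show ?case using g1 g2 by blast
qed

text \<open>Labels are constant along edges, so in a connected graph only one label remains, and the
  component count of \<open>forest_component_labelling\<close> becomes 1.\<close>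

lemma card_tree_graph:
  fixes V :: "'a set"
  assumes "tree_graph V T"
  shows "card T + 1 = card V"
proof -
  have T: "finite V" "\<forall>e\<in>T. e \<subseteq> V \<and> card e = 2" "graph_cycles T = {}" "V \<noteq> {}"
    "\<And>u v. u \<in> V \<Longrightarrow> v \<in> V \<Longrightarrow> (u, v) \<in> (edge_rel V T)\<^sup>*"
    using assms unfolding tree_graph_def simple_graph_def connected_graph_iff by auto
  have "T \<subseteq> Pow V" using T(2) by blast
  then have "finite T" using T(1) finite_subset by blast
  from forest_component_labelling[OF T(1) this T(2,3)]
  obtain f :: "'a \<Rightarrow> 'a" where f: "\<forall>a b. {a, b} \<in> T \<longrightarrow> f a = f b" "card (f ` V) + card T = card V"
    by (elim exE conjE)
  have eq: "f u = f v" if "(u, v) \<in> (edge_rel V T)\<^sup>*" for u v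
    using that
  proof (induction rule: rtrancl_induct)
    case (step y z)
    then have "{y, z} \<in> T" using edge_relD by fast
    from f(1)[rule_format, OF this] step.IH show ?case by (rule trans[rotated])
  qed simp
  obtain r where r: "r \<in> V" using T(4) by blast
  have "f v \<in> {f r}" if "v \<in> V" for v using eq[OF T(5)[OF r that]] by simp
  then have "f ` V = {f r}" using r by blast
  then show ?thesis using f(2) by simp
qed

text \<open>Equal edges at distinct positions would have to be traversed in opposite directions,
  making each position the cyclic successor of the other; this fails once the length is at least
  3.\<close>

lemma cycle_edge_inj:
  assumes "distinct vs" "length vs \<ge> 3" "i < length vs" "j < length vs"
    and "{vs ! i, vs ! (Suc i mod length vs)} = {vs ! j, vs ! (Suc j mod length vs)}"
  shows "i = j"
proof (rule ccontr)
  assume ne: "i \<noteq> j"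
  have lt: "Suc k mod length vs < length vs" for k using assms(2) by (intro mod_less_divisor) linarith
  have nx: "Suc k mod length vs = 0 \<and> Suc k = length vs \<or> Suc k mod length vs = Suc k"
    if "k < length vs" for k using that by (cases "Suc k = length vs") auto
  have "vs ! i \<noteq> vs ! j" using ne assms(1,3,4) by (simp add: nth_eq_iff_index_eq)
  then have "vs ! i = vs ! (Suc j mod length vs)" "vs ! j = vs ! (Suc i mod length vs)"
    using assms(5) unfolding doubleton_eq_iff by simp_all
  then have "i = Suc j mod length vs" "j = Suc i mod length vs"
    using nth_eq_iff_index_eq[OF assms(1)] assms(3,4) lt by blast+
  then show False using nx[OF assms(3)] nx[OF assms(4)] assms(2) by linarith
qed

text \<open>Go round the cycle from the far end of edge \<open>i\<close>; after
  \<open>length vs - 1\<close> steps the walk arrives at vertex \<open>i\<close> without having used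
  that edge.\<close>

lemma cycle_edge_removal_connected:
  assumes "distinct vs" "length vs \<ge> 3" "cycle_edges vs \<subseteq> E" "set vs \<subseteq> V" "i < length vs"
  defines "e \<equiv> {vs ! i, vs ! (Suc i mod length vs)}"
  shows "(vs ! (Suc i mod length vs), vs ! i) \<in> (edge_rel V (E - {e}))\<^sup>*"
proof -
  let ?N = "length vs"
  let ?R = "edge_rel V (E - {e})"
  have N: "0 < ?N" using assms(2) by linarith
  have "(vs ! (Suc i mod ?N), vs ! ((Suc i + k) mod ?N)) \<in> ?R\<^sup>*" if "k < ?N" for k
    using that
  proof (induction k)
    case 0
    show ?case by simp
  next
    case (Suc k)
    let ?j = "(Suc i + k) mod ?N"
    have j: "?j < ?N" using N by simp
    \<comment> \<open>Position \<open>i\<close> would recur only after a full turn, that is, if the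
      length divided \<open>Suc k\<close>, which is positive and smaller.\<close>
    have "?j \<noteq> i"
    proof
      assume "?j = i"
      then have "(i + Suc k) mod ?N = i mod ?N" using assms(5) by simp
      then have "Suc k mod ?N = 0"
        by (metis Nat.add_0_right add_left_cancel mod_eq_dvd_iff_nat diff_add_inverse le_add1 dvd_imp_mod_0)
      then show False using Suc.prems by simp
    qed
    have nx: "Suc ?j mod ?N = (Suc i + Suc k) mod ?N" by (simp add: mod_Suc_eq)
    have "{vs ! ?j, vs ! (Suc ?j mod ?N)} \<in> E"
      using assms(3) j unfolding cycle_edges_def by blast
    moreover have "{vs ! ?j, vs ! (Suc ?j mod ?N)} \<noteq> e"
      using cycle_edge_inj[OF assms(1,2) j assms(5)] \<open>?j \<noteq> i\<close> unfolding e_def by blast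
    moreover have "vs ! ?j \<in> V" "vs ! (Suc ?j mod ?N) \<in> V"
      using assms(4) j N by (auto intro!: subsetD[OF assms(4)] nth_mem)
    ultimately have "(vs ! ?j, vs ! (Suc ?j mod ?N)) \<in> ?R"
      by (intro edge_relI) auto
    then show ?case using Suc unfolding nx by (meson Suc_lessD rtrancl.rtrancl_into_rtrancl)
  qed
  from this[of "?N - 1"] show ?thesis using N assms(5) by simp
qed

text \<open>Each use of \<open>e\<close> can be rerouted along the rest of the cycle, so
  connectedness survives. A remaining cycle would also be a cycle of \<open>E\<close>, hence equal
  to \<open>C\<close>, which contains \<open>e\<close>.\<close>

lemma unicyclic_remove_cycle_edge:
  assumes "simple_graph V E" "connected_graph V E" "graph_cycles E = {C}" "e \<in> C"
  shows "tree_graph V (E - {e})"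
proof -
  have "C \<in> graph_cycles E" using assms(3) by simp
  then obtain vs where vs: "C = cycle_edges vs" "distinct vs" "length vs \<ge> 3" "cycle_edges vs \<subseteq> E"
    unfolding graph_cycles_def by blast
  let ?N = "length vs"
  let ?R = "edge_rel V (E - {e})"
  obtain i where i: "i < ?N" "e = {vs ! i, vs ! (Suc i mod ?N)}"
    using assms(4) unfolding vs(1) cycle_edges_def by blast
  have sub: "set vs \<subseteq> V"
  proof
    fix x assume "x \<in> set vs"
    then obtain j where j: "j < ?N" "x = vs ! j" by (metis in_set_conv_nth)
    then have "{vs ! j, vs ! (Suc j mod ?N)} \<in> E" using vs(4) unfolding cycle_edges_def by blast
    then show "x \<in> V" using assms(1) j unfolding simple_graph_def by blast
  qed
  have ends: "(vs ! (Suc i mod ?N), vs ! i) \<in> ?R\<^sup>*"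
    using cycle_edge_removal_connected[OF vs(2-4) sub i(1)] i(2) by simp
  have one: "(a, b) \<in> ?R\<^sup>*" if ab: "(a, b) \<in> edge_rel V E" for a b
  proof (cases "{a, b} = e")
    case True
    then show ?thesis using ends edge_rel_rtrancl_sym[OF ends] i(2) by (auto simp: doubleton_eq_iff)
  next
    case False
    then have "(a, b) \<in> ?R" using edge_relD[OF ab] by (intro edge_relI) auto
    then show ?thesis by (rule r_into_rtrancl)
  qed
  then have "edge_rel V E \<subseteq> ?R\<^sup>*" by (rule subrelI)
  then have "(edge_rel V E)\<^sup>* \<subseteq> ?R\<^sup>*" by (metis rtrancl_mono rtrancl_idemp)
  then have "connected_graph V (E - {e})"
    using assms(2) unfolding connected_graph_iff by blast
  moreover have "graph_cycles (E - {e}) = {}"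
  proof (rule ccontr)
    assume "graph_cycles (E - {e}) \<noteq> {}"
    then obtain D where D: "D \<in> graph_cycles (E - {e})" by blast
    then have "D \<in> graph_cycles E" using graph_cycles_mono[of "E - {e}" E] by blast
    then have "C \<in> graph_cycles (E - {e})" using D assms(3) by simp
    then have "C \<subseteq> E - {e}" unfolding graph_cycles_def by blast
    then show False using assms(4) by blast
  qed
  ultimately show ?thesis using assms(1) unfolding tree_graph_def simple_graph_def by blast
qed

lemma unicyclic_spanning_complex:
  assumes "simple_graph V E" "connected_graph V E" "graph_cycles E = {C}"
  shows "C \<subseteq> E" "C \<noteq> {}" "card E = card V"
    "spanning_complex V E = {F. F \<subseteq> E \<and> \<not> C \<subseteq> F}"
proof -
  have "C \<in> graph_cycles E" using assms(3) by simp
  then obtain vs where vs: "C = cycle_edges vs" "distinct vs" "length vs \<ge> 3" "cycle_edges vs \<subseteq> E"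
    unfolding graph_cycles_def by blast
  show CE: "C \<subseteq> E" using vs by simp
  have "{vs ! 0, vs ! (Suc 0 mod length vs)} \<in> cycle_edges vs"
    unfolding cycle_edges_def using vs(3) by (intro CollectI exI[of _ 0]) auto
  then obtain e where e: "e \<in> C" using vs(1) by blast
  then show "C \<noteq> {}" by blast
  have "finite E" using assms(1) finite_subset[of E "Pow V"] unfolding simple_graph_def by blast
  then have "card E = card (E - {e}) + 1" using e CE by (metis Suc_eq_plus1 card.remove subsetD)
  then show "card E = card V"
    using card_tree_graph[OF unicyclic_remove_cycle_edge[OF assms e]] by simp
  show "spanning_complex V E = {F. F \<subseteq> E \<and> \<not> C \<subseteq> F}"
  proof (intro Set.set_eqI iffI)
    fix F assume "F \<in> spanning_complex V E"
    then obtain T where T: "T \<subseteq> E" "tree_graph V T" "F \<subseteq> T"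
      unfolding spanning_complex_def spanning_trees_def by blast
    have "C \<in> graph_cycles T" if "C \<subseteq> T"
      using vs that unfolding graph_cycles_def by blast
    then have "\<not> C \<subseteq> T" using T(2) unfolding tree_graph_def by (metis empty_iff)
    then show "F \<in> {F. F \<subseteq> E \<and> \<not> C \<subseteq> F}" using T(1,3) by blast
  next
    fix F assume "F \<in> {F. F \<subseteq> E \<and> \<not> C \<subseteq> F}"
    then have F: "F \<subseteq> E" "\<not> C \<subseteq> F" by simp_all
    then obtain a where a: "a \<in> C" "a \<notin> F" by blast
    then have "tree_graph V (E - {a})" "F \<subseteq> E - {a}"
      using unicyclic_remove_cycle_edge[OF assms a(1)] F by auto
    then show "F \<in> spanning_complex V E"
      unfolding spanning_complex_def spanning_trees_def by blast
  qed
qed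

section \<open>Polynomial rings and Stanley-Reisner ideals\<close>

text \<open>Natural exponents cannot cancel, so the inclusion that holds in general is an equality
  here: the support of a product of monomials is the union of the supports.\<close>

lemma keys_add_nat [simp]:
  "Poly_Mapping.keys (t + u) = Poly_Mapping.keys t \<union> Poly_Mapping.keys (u :: 'x \<Rightarrow>\<^sub>0 nat)"
  by (auto simp: in_keys_iff lookup_add)

lemma poly_mapping_sum_single:
  "(\<Sum>t\<in>Poly_Mapping.keys p. Poly_Mapping.single t (Poly_Mapping.lookup p t)) = p"
  by (rule poly_mapping_eqI) (auto simp: lookup_sum lookup_single when_def in_keys_iff)

lemma lookup_times_sum_keys:
  fixes p q :: "'a::monoid_add \<Rightarrow>\<^sub>0 'b::semiring_0"
  shows "Poly_Mapping.lookup (p * q) t =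
    (\<Sum>a\<in>Poly_Mapping.keys p. \<Sum>b\<in>Poly_Mapping.keys q.
       Poly_Mapping.lookup p a * Poly_Mapping.lookup q b when a + b = t)"
proof -
  have "p * q = (\<Sum>a\<in>Poly_Mapping.keys p. \<Sum>b\<in>Poly_Mapping.keys q.
      Poly_Mapping.single (a + b) (Poly_Mapping.lookup p a * Poly_Mapping.lookup q b))"
    by (subst (1) poly_mapping_sum_single[symmetric], subst (2) poly_mapping_sum_single[symmetric])
      (simp add: sum_product mult_single)
  then show ?thesis by (simp add: lookup_sum lookup_single)
qed

section \<open>The ring structure on polynomials in a given set of variables\<close>

lemma mvpoly_ring_simps [simp]:
  "mult (mvpoly_ring X) = (*)" "one (mvpoly_ring X) = 1"
  "zero (mvpoly_ring X) = 0" "add (mvpoly_ring X) = (+)"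
  by (simp_all add: mvpoly_ring_def)

lemma mvpoly_ring_carrier_iff:
  "p \<in> carrier (mvpoly_ring X) \<longleftrightarrow> (\<forall>t\<in>Poly_Mapping.keys p. Poly_Mapping.keys t \<subseteq> X)"
  by (simp add: mvpoly_ring_def)

lemma mvpoly_ring_carrier_closed:
  shows "0 \<in> carrier (mvpoly_ring X)" "1 \<in> carrier (mvpoly_ring X)"
    and "p \<in> carrier (mvpoly_ring X) \<Longrightarrow> q \<in> carrier (mvpoly_ring X) \<Longrightarrow> p + q \<in> carrier (mvpoly_ring X)"
    and "p \<in> carrier (mvpoly_ring X) \<Longrightarrow> - p \<in> carrier (mvpoly_ring X)"
    and "p \<in> carrier (mvpoly_ring X) \<Longrightarrow> q \<in> carrier (mvpoly_ring X) \<Longrightarrow> p * q \<in> carrier (mvpoly_ring X)"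
    and "mvconst c \<in> carrier (mvpoly_ring X)"
proof -
  show "0 \<in> carrier (mvpoly_ring X)" "1 \<in> carrier (mvpoly_ring X)"
    "mvconst c \<in> carrier (mvpoly_ring X)"
    "p \<in> carrier (mvpoly_ring X) \<Longrightarrow> - p \<in> carrier (mvpoly_ring X)"
    by (auto simp: mvpoly_ring_carrier_iff mvconst_def)
  show "p + q \<in> carrier (mvpoly_ring X)"
    if "p \<in> carrier (mvpoly_ring X)" "q \<in> carrier (mvpoly_ring X)"
    using that keys_add[of p q] unfolding mvpoly_ring_carrier_iff by blast
  show "p * q \<in> carrier (mvpoly_ring X)"
    if "p \<in> carrier (mvpoly_ring X)" "q \<in> carrier (mvpoly_ring X)"
    unfolding mvpoly_ring_carrier_iff
  proof
    fix t assume "t \<in> Poly_Mapping.keys (p * q)"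
    then obtain a b where "t = a + b" "a \<in> Poly_Mapping.keys p" "b \<in> Poly_Mapping.keys q"
      using keys_mult[of p q] by blast
    then show "Poly_Mapping.keys t \<subseteq> X" using that by (simp add: mvpoly_ring_carrier_iff)
  qed
qed

lemma cring_mvpoly_ring: "cring (mvpoly_ring X)"
proof (rule cringI)
  show "abelian_group (mvpoly_ring X)"
    by (rule abelian_groupI)
      (auto simp: mvpoly_ring_carrier_closed algebra_simps
        intro: bexI[of _ "- x" for x] mvpoly_ring_carrier_closed(4))
  show "Group.comm_monoid (mvpoly_ring X)"
    by (rule comm_monoidI) (auto simp: mvpoly_ring_carrier_closed algebra_simps)
qed (simp add: algebra_simps)

lemma ring_mvpoly_ring: "ring (mvpoly_ring X)"
  using cring_mvpoly_ring cring.axioms(1) by blast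

lemma mvpoly_ring_uminus:
  assumes "p \<in> carrier (mvpoly_ring X)"
  shows "\<ominus>\<^bsub>mvpoly_ring X\<^esub> p = - p"
proof -
  interpret cring "mvpoly_ring X" by (rule cring_mvpoly_ring)
  show ?thesis
    using minus_equality[of "- p" p] assms by (simp add: mvpoly_ring_carrier_closed)
qed

lemma mvpoly_ring_minus:
  assumes "p \<in> carrier (mvpoly_ring X)" "q \<in> carrier (mvpoly_ring X)"
  shows "p \<ominus>\<^bsub>mvpoly_ring X\<^esub> q = p - q"
  using assms by (simp add: a_minus_def mvpoly_ring_uminus)

lemma mvpoly_ring_sum_closed:
  "(\<And>i. i \<in> A \<Longrightarrow> f i \<in> carrier (mvpoly_ring X)) \<Longrightarrow> sum f A \<in> carrier (mvpoly_ring X)"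
  by (induction A rule: infinite_finite_induct) (auto simp: mvpoly_ring_carrier_closed)

lemma mvpoly_ring_power_closed:
  "p \<in> carrier (mvpoly_ring X) \<Longrightarrow> p ^ k \<in> carrier (mvpoly_ring X)"
  by (induction k) (auto simp: mvpoly_ring_carrier_closed)

text \<open>Negatives come from multiplying by \<open>- 1\<close>, and commutativity makes one-sided
  absorption two-sided.\<close>

lemma ideal_mvpoly_ringI:
  assumes "J \<subseteq> carrier (mvpoly_ring X)" "0 \<in> J"
    and "\<And>p q. p \<in> J \<Longrightarrow> q \<in> J \<Longrightarrow> p + q \<in> J"
    and "\<And>p q. p \<in> J \<Longrightarrow> q \<in> carrier (mvpoly_ring X) \<Longrightarrow> p * q \<in> J"
  shows "ideal J (mvpoly_ring X)"
proof (rule idealI[OF ring_mvpoly_ring])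
  interpret cring "mvpoly_ring X" by (rule cring_mvpoly_ring)
  show "subgroup J (add_monoid (mvpoly_ring X))"
  proof (rule add.subgroupI)
    show "J \<subseteq> carrier (mvpoly_ring X)" "J \<noteq> {}" using assms(1,2) by auto
    show "\<ominus>\<^bsub>mvpoly_ring X\<^esub> a \<in> J" if "a \<in> J" for a
    proof -
      have "a * (- 1) \<in> J"
        by (rule assms(4)[OF that]) (intro mvpoly_ring_carrier_closed)
      then show ?thesis using that assms(1) by (auto simp: mvpoly_ring_uminus)
    qed
    show "a \<oplus>\<^bsub>mvpoly_ring X\<^esub> b \<in> J" if "a \<in> J" "b \<in> J" for a b
      using assms(3)[OF that] by simp
  qed
qed (use assms(4) in \<open>simp_all add: mult.commute\<close>)

text \<open>The monomial form of the Stanley-Reisner ideal, see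
  \<open>stanley_reisner_ideal_eq\<close>. For \<open>\<Delta> = Pow G\<close> it is the ideal
  generated by the variables of \<open>X\<close> outside \<open>G\<close>, which supplies the primes
  of the Krull dimension argument.\<close>

definition nonface_polys :: "'x set \<Rightarrow> 'x set set \<Rightarrow> ('x, 'k::field) mvpoly set" where
  "nonface_polys X \<Delta> =
     {p \<in> carrier (mvpoly_ring X). \<forall>t\<in>Poly_Mapping.keys p. Poly_Mapping.keys t \<notin> \<Delta>}"

text \<open>The support of a product monomial contains that of each factor, and supersets of
  nonfaces are nonfaces.\<close>

lemma ideal_nonface_polys:
  assumes "\<And>F G. F \<in> \<Delta> \<Longrightarrow> G \<subseteq> F \<Longrightarrow> G \<in> \<Delta>"
  shows "ideal (nonface_polys X \<Delta>) (mvpoly_ring X)"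
proof (rule ideal_mvpoly_ringI)
  show "p + q \<in> nonface_polys X \<Delta>" if "p \<in> nonface_polys X \<Delta>" "q \<in> nonface_polys X \<Delta>"
    for p q :: "('a, 'b) mvpoly"
  proof -
    have "p + q \<in> carrier (mvpoly_ring X)"
      using that by (simp add: nonface_polys_def mvpoly_ring_carrier_closed)
    then show ?thesis using that keys_add[of p q] unfolding nonface_polys_def by blast
  qed
  show "p * q \<in> nonface_polys X \<Delta>" if "p \<in> nonface_polys X \<Delta>" "q \<in> carrier (mvpoly_ring X)"
    for p q :: "('a, 'b) mvpoly"
  proof -
    have "Poly_Mapping.keys t \<notin> \<Delta>" if t: "t \<in> Poly_Mapping.keys (p * q)" for t
    proof -
      obtain a b where ab: "t = a + b" "a \<in> Poly_Mapping.keys p"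
        using t keys_mult[of p q] by blast
      then have "Poly_Mapping.keys a \<notin> \<Delta>"
        using \<open>p \<in> nonface_polys X \<Delta>\<close> by (simp add: nonface_polys_def)
      then show ?thesis using assms[of "Poly_Mapping.keys t" "Poly_Mapping.keys a"] ab by auto
    qed
    then show ?thesis
      using that by (simp add: nonface_polys_def mvpoly_ring_carrier_closed)
  qed
qed (auto simp: nonface_polys_def mvpoly_ring_carrier_closed)

lemma lookup_sum_single_1:
  "finite F \<Longrightarrow> Poly_Mapping.lookup (\<Sum>x\<in>F. Poly_Mapping.single x (1::nat)) y = (if y \<in> F then 1 else 0)"
  by (simp add: lookup_sum lookup_single when_def)

lemma prod_mvvar:
  "finite F \<Longrightarrow> (\<Prod>x\<in>F. mvvar x) = Poly_Mapping.single (\<Sum>x\<in>F. Poly_Mapping.single x 1) 1"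
  by (induction F rule: finite_induct) (simp_all add: mvvar_def mult_single)

lemma keys_sum_single_1:
  "finite F \<Longrightarrow> Poly_Mapping.keys (\<Sum>x\<in>F. Poly_Mapping.single x (1::nat)) = F"
  by (auto simp: in_keys_iff lookup_sum_single_1 simp del: One_nat_def split: if_splits)

locale simplicial_complex =
  fixes X :: "'x set" and \<Delta> :: "'x set set"
  assumes finite_vertices: "finite X"
    and face_subset: "F \<in> \<Delta> \<Longrightarrow> F \<subseteq> X"
    and face_down: "F \<in> \<Delta> \<Longrightarrow> G \<subseteq> F \<Longrightarrow> G \<in> \<Delta>"
    and empty_face: "{} \<in> \<Delta>"
begin

lemma finite_face: "F \<in> \<Delta> \<Longrightarrow> finite F"
  using face_subset finite_vertices finite_subset by blast

lemma finite_complex: "finite \<Delta>"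
  using face_subset finite_vertices by (intro finite_subset[of \<Delta> "Pow X"]) auto

text \<open>The generators are nonface monomials. Conversely, each term of a polynomial in
  \<open>nonface_polys\<close> is a multiple of the squarefree monomial of its support, which is a
  generator.\<close>

lemma stanley_reisner_ideal_eq:
  "stanley_reisner_ideal X \<Delta> = (nonface_polys X \<Delta> :: ('x, 'k::field) mvpoly set)"
proof -
  let ?R = "mvpoly_ring X :: ('x, 'k) mvpoly ring"
  let ?S = "{(\<Prod>x\<in>F. mvvar x) | F. F \<subseteq> X \<and> F \<notin> \<Delta>} :: ('x, 'k) mvpoly set"
  interpret cring ?R by (rule cring_mvpoly_ring)
  have idJ: "ideal (nonface_polys X \<Delta>) ?R"
    by (rule ideal_nonface_polys) (rule face_down)
  have gen: "(\<Prod>x\<in>F. mvvar x) = (Poly_Mapping.single (\<Sum>x\<in>F. Poly_Mapping.single x 1) 1 :: ('x, 'k) mvpoly)"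
    "Poly_Mapping.keys (\<Sum>x\<in>F. Poly_Mapping.single x (1::nat)) = F" if "F \<subseteq> X" for F
    using that finite_subset[OF that finite_vertices] prod_mvvar keys_sum_single_1 by blast+
  have SJ: "?S \<subseteq> nonface_polys X \<Delta>"
  proof clarify
    fix F assume "F \<subseteq> X" "F \<notin> \<Delta>"
    then show "(\<Prod>x\<in>F. mvvar x) \<in> (nonface_polys X \<Delta> :: ('x, 'k) mvpoly set)"
      by (simp add: gen nonface_polys_def mvpoly_ring_carrier_iff del: One_nat_def)
  qed
  have SR: "?S \<subseteq> carrier ?R" using SJ by (auto simp: nonface_polys_def)
  interpret I: ideal "genideal ?R ?S" ?R by (rule genideal_ideal[OF SR])
  show ?thesis unfolding stanley_reisner_ideal_def
  proof
    show "genideal ?R ?S \<subseteq> nonface_polys X \<Delta>" by (rule genideal_minimal[OF idJ SJ])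
    show "nonface_polys X \<Delta> \<subseteq> genideal ?R ?S"
    proof
      fix p :: "('x, 'k) mvpoly"
      assume p: "p \<in> nonface_polys X \<Delta>"
      have "Poly_Mapping.single t (Poly_Mapping.lookup p t) \<in> genideal ?R ?S"
        if t: "t \<in> Poly_Mapping.keys p" for t
      proof -
        let ?F = "Poly_Mapping.keys t"
        let ?u = "\<Sum>x\<in>?F. Poly_Mapping.single x (1::nat)"
        have F: "?F \<subseteq> X" "?F \<notin> \<Delta>"
          using p t by (auto simp: nonface_polys_def mvpoly_ring_carrier_iff)
        \<comment> \<open>Subtraction of exponents truncates at 0, but each exponent on the support
          is at least 1, so nothing is lost.\<close>
        have tu: "(t - ?u) + ?u = t"
          by (rule poly_mapping_eqI)
            (auto simp: lookup_add lookup_minus lookup_sum_single_1 in_keys_iff simp del: One_nat_def)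
        have "(\<Prod>x\<in>?F. mvvar x) \<in> ?S" using F by blast
        then have g: "(\<Prod>x\<in>?F. mvvar x) \<in> genideal ?R ?S"
          using genideal_self[OF SR] by blast
        have "Poly_Mapping.keys (t - ?u) \<subseteq> ?F"
          by (auto simp: in_keys_iff lookup_minus)
        then have "Poly_Mapping.single (t - ?u) (Poly_Mapping.lookup p t) \<in> carrier ?R"
          using F(1) by (auto simp: mvpoly_ring_carrier_iff)
        from I.I_l_closed[OF g this] show ?thesis
          by (simp add: gen(1)[OF F(1)] mult_single tu del: One_nat_def)
      qed
      then have "(\<Sum>t\<in>T. Poly_Mapping.single t (Poly_Mapping.lookup p t)) \<in> genideal ?R ?S"
        if "T \<subseteq> Poly_Mapping.keys p" for T
        using that I.zero_closed I.a_closed finite_subset[OF that finite_keys]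
        by (induction T rule: infinite_finite_induct) auto
      from this[of "Poly_Mapping.keys p"] show "p \<in> genideal ?R ?S"
        by (simp add: poly_mapping_sum_single)
    qed
  qed
qed

end

section \<open>Counting monomials by support\<close>

definition monomial_degree :: "('x \<Rightarrow>\<^sub>0 nat) \<Rightarrow> nat" where
  "monomial_degree t = (\<Sum>x\<in>Poly_Mapping.keys t. Poly_Mapping.lookup t x)"

lemma monomial_degree_superset:
  "finite A \<Longrightarrow> Poly_Mapping.keys t \<subseteq> A \<Longrightarrow> monomial_degree t = (\<Sum>x\<in>A. Poly_Mapping.lookup t x)"
  unfolding monomial_degree_def by (rule sum.mono_neutral_left) (auto simp: in_keys_iff)

lemma monomial_degree_add: "monomial_degree (t + u) = monomial_degree t + monomial_degree u"
proof -
  let ?A = "Poly_Mapping.keys t \<union> Poly_Mapping.keys u"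
  have "finite ?A" by simp
  then show ?thesis
    using monomial_degree_superset[of ?A t] monomial_degree_superset[of ?A u]
      monomial_degree_superset[of ?A "t + u"] by (simp add: lookup_add sum.distrib)
qed

lemma monomial_degree_single [simp]: "monomial_degree (Poly_Mapping.single x k) = k"
  by (simp add: monomial_degree_def)

lemma monomial_degree_eq_0_iff: "monomial_degree t = 0 \<longleftrightarrow> Poly_Mapping.keys t = {}"
proof
  assume "monomial_degree t = 0"
  then have "\<forall>x\<in>Poly_Mapping.keys t. Poly_Mapping.lookup t x = 0"
    by (simp add: monomial_degree_def)
  then show "Poly_Mapping.keys t = {}" by (meson all_not_in_conv in_keys_iff)
qed (simp add: monomial_degree_def)

definition support_monomials :: "'x set \<Rightarrow> nat \<Rightarrow> ('x \<Rightarrow>\<^sub>0 nat) set" where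
  "support_monomials F i = {t. Poly_Mapping.keys t = F \<and> monomial_degree t = i}"

lemma support_monomials_empty: "support_monomials {} i = (if i = 0 then {0} else {})"
  by (auto simp: support_monomials_def monomial_degree_def)

lemma support_monomials_insert_0: "support_monomials (insert x F) 0 = {}"
  by (auto simp: support_monomials_def monomial_degree_eq_0_iff)

text \<open>Dividing by \<open>x\<close> once leaves the support unchanged if the exponent of
  \<open>x\<close> exceeds 1, and removes \<open>x\<close> from it otherwise.\<close>

lemma support_monomials_insert_Suc:
  assumes "x \<notin> F"
  shows "support_monomials (insert x F) (Suc i) =
    (\<lambda>t. t + Poly_Mapping.single x 1) ` (support_monomials (insert x F) i \<union> support_monomials F i)"
    (is "?L = ?f ` ?R")
proof
  show "?f ` ?R \<subseteq> ?L"
  proof (rule image_subsetI)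
    fix t assume "t \<in> ?R"
    then have "Poly_Mapping.keys t = insert x F \<or> Poly_Mapping.keys t = F" "monomial_degree t = i"
      unfolding support_monomials_def by blast+
    then show "?f t \<in> ?L" by (elim disjE) (simp_all add: support_monomials_def monomial_degree_add)
  qed
  show "?L \<subseteq> ?f ` ?R"
  proof
    fix t assume t: "t \<in> ?L"
    define u where "u = t - Poly_Mapping.single x 1"
    have kt: "Poly_Mapping.keys t = insert x F" "monomial_degree t = Suc i"
      using t by (auto simp: support_monomials_def)
    have "Poly_Mapping.lookup t x \<noteq> 0" using kt(1) by (auto simp: in_keys_iff)
    then have tu: "t = ?f u"
      by (intro poly_mapping_eqI) (auto simp: u_def lookup_add lookup_minus lookup_single when_def)
    have "Poly_Mapping.keys u \<union> {x} = insert x F" using kt(1) unfolding tu by simp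
    then have "Poly_Mapping.keys u = insert x F \<or> Poly_Mapping.keys u = F" using assms by auto
    moreover have "monomial_degree u = i"
      using kt(2) unfolding tu by (simp add: monomial_degree_add)
    ultimately show "t \<in> ?f ` ?R" using tu by (auto simp: support_monomials_def)
  qed
qed

lemma finite_support_monomials: "finite F \<Longrightarrow> finite (support_monomials F i)"
proof (induction F arbitrary: i rule: finite_induct)
  case (insert x F)
  show ?case
    by (induction i) (simp_all add: support_monomials_insert_0 support_monomials_insert_Suc insert)
qed (simp add: support_monomials_empty)

lemma card_support_monomials_insert_Suc:
  assumes "finite F" "x \<notin> F"
  shows "card (support_monomials (insert x F) (Suc i)) =
    card (support_monomials (insert x F) i) + card (support_monomials F i)"
proof -
  have "support_monomials (insert x F) i \<inter> support_monomials F i = {}"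
    using assms(2) by (auto simp: support_monomials_def)
  then show ?thesis
    unfolding support_monomials_insert_Suc[OF assms(2)]
    by (subst card_image) (simp_all add: inj_on_def card_Un_disjoint finite_support_monomials assms(1))
qed

text \<open>The counting recursion says that adjoining a vertex multiplies the series by X / (1 -
  X).\<close>

lemma support_monomials_series:
  "finite F \<Longrightarrow> Abs_fps (\<lambda>i. int (card (support_monomials F i))) * (1 - fps_X) ^ card F = fps_X ^ card F"
proof (induction F rule: finite_induct)
  case empty
  then show ?case by (intro fps_ext) (simp add: support_monomials_empty)
next
  case (insert x F)
  let ?G = "\<lambda>F. Abs_fps (\<lambda>i. int (card (support_monomials F i)))"
  have "?G (insert x F) * (1 - fps_X) = fps_X * ?G F"
  proof (rule fps_ext)
    fix i
    show "fps_nth (?G (insert x F) * (1 - fps_X)) i = fps_nth (fps_X * ?G F) i"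
      using card_support_monomials_insert_Suc[OF insert.hyps]
      by (cases i) (simp_all add: right_diff_distrib support_monomials_insert_0)
  qed
  then have "?G (insert x F) * (1 - fps_X) ^ card (insert x F) =
      fps_X * (?G F * (1 - fps_X) ^ card F)"
    using insert.hyps by (simp add: mult.assoc[symmetric])
  then show ?case using insert by simp
qed

section \<open>Monomials supported on faces and the numerator of their series\<close>

context simplicial_complex
begin

definition face_monomials :: "nat \<Rightarrow> ('x \<Rightarrow>\<^sub>0 nat) set" where
  "face_monomials i = {t. Poly_Mapping.keys t \<in> \<Delta> \<and> monomial_degree t = i}"

lemma face_monomials_eq: "face_monomials i = (\<Union>F\<in>\<Delta>. support_monomials F i)"
  by (auto simp: face_monomials_def support_monomials_def)

lemma finite_face_monomials: "finite (face_monomials i)"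
  unfolding face_monomials_eq using finite_complex finite_face finite_support_monomials by blast

lemma card_face_monomials: "card (face_monomials i) = (\<Sum>F\<in>\<Delta>. card (support_monomials F i))"
  unfolding face_monomials_eq
  by (rule card_UN_disjoint)
    (use finite_complex finite_face finite_support_monomials in \<open>auto simp: support_monomials_def\<close>)

text \<open>The numerator over the denominator (1 - X)^d; \<open>[:1, -1:]\<close> is 1 - X. The
  parameter \<open>d\<close> is meant to bound all face sizes, so that \<open>d - card F\<close>
  does not truncate.\<close>

definition face_h_poly :: "nat \<Rightarrow> int poly" where
  "face_h_poly d = (\<Sum>F\<in>\<Delta>. Polynomial.monom 1 (card F) * [:1, -1:] ^ (d - card F))"

lemma face_monomials_series:
  assumes "\<And>F. F \<in> \<Delta> \<Longrightarrow> card F \<le> d"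
  shows "Abs_fps (\<lambda>i. int (card (face_monomials i))) * (1 - fps_X) ^ d = fps_of_poly (face_h_poly d)"
proof -
  let ?G = "\<lambda>F. Abs_fps (\<lambda>i. int (card (support_monomials F i)))"
  have "Abs_fps (\<lambda>i. int (card (face_monomials i))) = (\<Sum>F\<in>\<Delta>. ?G F)"
    by (rule fps_ext) (simp add: card_face_monomials fps_sum_nth)
  then have "Abs_fps (\<lambda>i. int (card (face_monomials i))) * (1 - fps_X) ^ d =
      (\<Sum>F\<in>\<Delta>. ?G F * (1 - fps_X) ^ d)" by (simp add: sum_distrib_right)
  also have "\<dots> = (\<Sum>F\<in>\<Delta>. fps_X ^ card F * (1 - fps_X) ^ (d - card F))"
  proof (rule sum.cong)
    fix F assume F: "F \<in> \<Delta>"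
    have "(1 - fps_X :: int fps) ^ d = (1 - fps_X) ^ card F * (1 - fps_X) ^ (d - card F)"
      using assms[OF F] by (simp flip: power_add)
    then show "?G F * (1 - fps_X) ^ d = fps_X ^ card F * (1 - fps_X) ^ (d - card F)"
      using support_monomials_series[OF finite_face[OF F]] by (metis mult.assoc)
  qed simp
  also have "\<dots> = fps_of_poly (face_h_poly d)"
  proof -
    have "fps_of_poly [:1, -1:] = (1 - fps_X :: int fps)"
      by (rule fps_ext) (auto simp: coeff_pCons fps_X_def split: nat.split)
    then show ?thesis
      by (simp only: face_h_poly_def fps_of_poly_sum fps_of_poly_mult fps_of_poly_power
          fps_of_poly_monom fps_const_1_eq_1 mult_1_left)
  qed
  finally show ?thesis .
qed

text \<open>At 1 only faces of size \<open>d\<close> survive, because \<open>0 ^ 0 = 1\<close>, and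
  all contributions are nonnegative.\<close>

lemma poly_face_h_poly_1:
  assumes "F \<in> \<Delta>" "card F = d" "\<And>F. F \<in> \<Delta> \<Longrightarrow> card F \<le> d"
  shows "poly (face_h_poly d) 1 \<noteq> 0"
proof -
  have "poly (face_h_poly d) 1 = (\<Sum>F\<in>\<Delta>. 0 ^ (d - card F))"
    by (simp add: face_h_poly_def poly_sum poly_monom)
  moreover have "(\<Sum>F\<in>\<Delta>. 0 ^ (d - card F)) \<ge> (0 ^ (d - card F) :: int)"
    using assms(1) finite_complex by (intro member_le_sum) auto
  ultimately show ?thesis using assms(2) by simp
qed

end

section \<open>Coefficients of the numerator in terms of face numbers\<close>

lemma coeff_one_minus_X_power:
  "Polynomial.coeff ([:1, -1:] ^ n :: int poly) j = (-1) ^ j * int (n choose j)"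
proof (induction n arbitrary: j)
  case (Suc n)
  then show ?case by (cases j) (auto simp: algebra_simps)
qed (auto simp: coeff_1)

context simplicial_complex
begin

lemma coeff_face_h_poly:
  assumes "\<And>F. F \<in> \<Delta> \<Longrightarrow> card F \<le> d"
  shows "Polynomial.coeff (face_h_poly d) k =
    (\<Sum>i=0..k. (-1) ^ (k - i) * int ((d - i) choose (k - i)) * int (card {F \<in> \<Delta>. card F = i}))"
proof -
  let ?c = "\<lambda>i. (-1) ^ (k - i) * int ((d - i) choose (k - i))"
  have "Polynomial.coeff (face_h_poly d) k = (\<Sum>F\<in>\<Delta>. if card F \<le> k then ?c (card F) else 0)"
    unfolding face_h_poly_def coeff_sum
    by (rule sum.cong) (auto simp: coeff_monom_mult coeff_one_minus_X_power)
  also have "\<dots> = (\<Sum>F\<in>{F \<in> \<Delta>. card F \<le> k}. ?c (card F))"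
    using finite_complex by (simp add: sum.inter_filter)
  \<comment> \<open>Grouping the faces by size turns the sum over faces into one over face
    numbers.\<close>
  also have "\<dots> = (\<Sum>i=0..k. \<Sum>F\<in>{F \<in> {F \<in> \<Delta>. card F \<le> k}. card F = i}. ?c (card F))"
    using finite_complex by (intro sum.group[symmetric]) auto
  also have "\<dots> = (\<Sum>i=0..k. ?c i * int (card {F \<in> \<Delta>. card F = i}))"
  proof (rule sum.cong)
    fix i assume "i \<in> {0..k}"
    then have "{F \<in> {F \<in> \<Delta>. card F \<le> k}. card F = i} = {F \<in> \<Delta>. card F = i}" by auto
    then show "(\<Sum>F\<in>{F \<in> {F \<in> \<Delta>. card F \<le> k}. card F = i}. ?c (card F)) =
      ?c i * int (card {F \<in> \<Delta>. card F = i})" by simp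
  qed simp
  finally show ?thesis .
qed

text \<open>Every summand has degree \<open>card F + (d - card F) = d\<close>.\<close>

lemma coeff_face_h_poly_eq_0:
  assumes "\<And>F. F \<in> \<Delta> \<Longrightarrow> card F \<le> d" "k > d"
  shows "Polynomial.coeff (face_h_poly d) k = 0"
  unfolding face_h_poly_def coeff_sum
proof (intro sum.neutral ballI)
  fix F assume "F \<in> \<Delta>"
  then show "Polynomial.coeff (Polynomial.monom 1 (card F) * [:1, -1:] ^ (d - card F) :: int poly) k = 0"
    using assms(1)[of F] assms(2) by (auto simp: coeff_monom_mult coeff_one_minus_X_power)
qed

end

section \<open>The Hilbert function\<close>

text \<open>\<open>ring.dim\<close> measures dimension over a subfield lying inside the ring, so the
  coefficient field has to be exhibited as one.\<close>

lemma subfield_mvconst: "subfield (range mvconst) (mvpoly_ring X :: ('x, 'k::field) mvpoly ring)"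
proof -
  let ?R = "mvpoly_ring X :: ('x, 'k) mvpoly ring"
  let ?K = "range mvconst :: ('x, 'k) mvpoly set"
  interpret cring ?R by (rule cring_mvpoly_ring)
  have eqs: "mvconst 0 = (0 :: ('x, 'k) mvpoly)" "mvconst 1 = (1 :: ('x, 'k) mvpoly)"
    "mvconst a + mvconst b = (mvconst (a + b) :: ('x, 'k) mvpoly)"
    "mvconst a * mvconst b = (mvconst (a * b) :: ('x, 'k) mvpoly)"
    "- mvconst a = (mvconst (- a) :: ('x, 'k) mvpoly)" for a b :: 'k
    by (simp_all add: mvconst_def single_add mult_single single_uminus)
  have inj: "mvconst a = (mvconst b :: ('x, 'k) mvpoly) \<longleftrightarrow> a = b" for a b :: 'k
    unfolding mvconst_def by (metis lookup_single_eq)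
  have sub: "subring ?K ?R"
  proof (rule subringI)
    show "?K \<subseteq> carrier ?R" by (auto simp: mvpoly_ring_carrier_closed)
    show "\<one>\<^bsub>?R\<^esub> \<in> ?K" by (simp flip: eqs)
    show "\<ominus>\<^bsub>?R\<^esub> h \<in> ?K" if "h \<in> ?K" for h
      using that by (auto simp: mvpoly_ring_uminus mvpoly_ring_carrier_closed eqs)
    show "h1 \<otimes>\<^bsub>?R\<^esub> h2 \<in> ?K" "h1 \<oplus>\<^bsub>?R\<^esub> h2 \<in> ?K" if "h1 \<in> ?K" "h2 \<in> ?K" for h1 h2
      using that by (auto simp: eqs)
  qed
  show ?thesis
  proof (rule subfieldI)
    show "subcring ?K ?R"
      by (rule subcringI[OF sub]) (auto simp: mult.commute)
    have "mvconst a \<in> Units (?R\<lparr>carrier := ?K\<rparr>) \<longleftrightarrow> a \<noteq> 0" for a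
    proof
      assume "mvconst a \<in> Units (?R\<lparr>carrier := ?K\<rparr>)"
      then obtain b where "mvconst b * mvconst a = (1 :: ('x, 'k) mvpoly)"
        by (auto simp: Units_def)
      then have "mvconst (b * a) = (mvconst 1 :: ('x, 'k) mvpoly)" by (simp add: eqs)
      then show "a \<noteq> 0" using inj by fastforce
    next
      assume "a \<noteq> 0"
      then have "mvconst (inverse a) * mvconst a = (1 :: ('x, 'k) mvpoly)" by (simp add: eqs)
      then show "mvconst a \<in> Units (?R\<lparr>carrier := ?K\<rparr>)"
        unfolding Units_def by (auto simp: mult.commute)
    qed
    moreover have "Units (?R\<lparr>carrier := ?K\<rparr>) \<subseteq> ?K" by (auto simp: Units_def)
    ultimately show "Units (?R\<lparr>carrier := ?K\<rparr>) = ?K - {\<zero>\<^bsub>?R\<^esub>}"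
      using inj by (auto simp flip: eqs(1))
  qed
qed

definition monomial_part :: "('x \<Rightarrow>\<^sub>0 nat) set \<Rightarrow> ('x, 'k::field) mvpoly \<Rightarrow> ('x, 'k) mvpoly" where
  "monomial_part M p = (\<Sum>t\<in>Poly_Mapping.keys p \<inter> M. Poly_Mapping.single t (Poly_Mapping.lookup p t))"

lemma lookup_monomial_part:
  "Poly_Mapping.lookup (monomial_part M p) t = (if t \<in> M then Poly_Mapping.lookup p t else 0)"
  by (auto simp: monomial_part_def lookup_sum lookup_single when_def in_keys_iff)

lemma keys_monomial_part: "Poly_Mapping.keys (monomial_part M p) = Poly_Mapping.keys p \<inter> M"
  by (auto simp: in_keys_iff lookup_monomial_part split: if_splits)

section \<open>Residue classes modulo the ideal and their linear algebra\<close>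

context simplicial_complex
begin

lemma ideal_nonface: "ideal (nonface_polys X \<Delta>) (mvpoly_ring X)"
  by (rule ideal_nonface_polys) (rule face_down)

text \<open>The difference lies in the ideal iff all its coefficients at face monomials vanish.
  Those coefficients are therefore well defined on residue classes, and face monomials act as a
  basis of the quotient.\<close>

lemma nonface_coset_eq_iff:
  assumes "p \<in> carrier (mvpoly_ring X)" "q \<in> carrier (mvpoly_ring X)"
  shows "nonface_polys X \<Delta> +>\<^bsub>mvpoly_ring X\<^esub> p = nonface_polys X \<Delta> +>\<^bsub>mvpoly_ring X\<^esub> q \<longleftrightarrow>
    (\<forall>t. Poly_Mapping.keys t \<in> \<Delta> \<longrightarrow> Poly_Mapping.lookup p t = Poly_Mapping.lookup q t)"
proof -
  have "p - q \<in> carrier (mvpoly_ring X)"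
    using assms mvpoly_ring_carrier_closed(3)[of p X "- q"] mvpoly_ring_carrier_closed(4)[of q X] by simp
  then have "p - q \<in> nonface_polys X \<Delta> \<longleftrightarrow>
      (\<forall>t. Poly_Mapping.keys t \<in> \<Delta> \<longrightarrow> Poly_Mapping.lookup p t = Poly_Mapping.lookup q t)"
    by (auto simp: nonface_polys_def in_keys_iff lookup_minus)
  then show ?thesis
    using ring.quotient_eq_iff_same_a_r_cos[OF ring_mvpoly_ring ideal_nonface assms]
    by (simp add: mvpoly_ring_minus assms)
qed

abbreviation face_ring :: "('x, 'k::field) mvpoly set ring" where
  "face_ring \<equiv> mvpoly_ring X Quot nonface_polys X \<Delta>"

abbreviation face_coset :: "('x, 'k::field) mvpoly \<Rightarrow> ('x, 'k) mvpoly set" where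
  "face_coset p \<equiv> nonface_polys X \<Delta> +>\<^bsub>mvpoly_ring X\<^esub> p"

lemma face_coset_hom: "ring_hom_ring (mvpoly_ring X) face_ring face_coset"
  using ideal.rcos_ring_hom_ring[OF ideal_nonface] .

lemma face_coset_arith:
  assumes "p \<in> carrier (mvpoly_ring X)" "q \<in> carrier (mvpoly_ring X)"
  shows "face_coset (p + q) = face_coset p \<oplus>\<^bsub>face_ring\<^esub> face_coset q"
    "face_coset (p * q) = face_coset p \<otimes>\<^bsub>face_ring\<^esub> face_coset q"
    "face_coset p \<in> carrier face_ring"
proof -
  interpret ring_hom_ring "mvpoly_ring X" face_ring face_coset by (rule face_coset_hom)
  show "face_coset (p + q) = face_coset p \<oplus>\<^bsub>face_ring\<^esub> face_coset q"
    "face_coset (p * q) = face_coset p \<otimes>\<^bsub>face_ring\<^esub> face_coset q"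
    "face_coset p \<in> carrier face_ring"
    using hom_add[OF assms] hom_mult[OF assms] hom_closed[OF assms(1)] by simp_all
qed

lemma face_coset_0: "face_coset 0 = \<zero>\<^bsub>face_ring\<^esub>"
proof -
  interpret ring_hom_ring "mvpoly_ring X" face_ring face_coset by (rule face_coset_hom)
  show ?thesis using hom_zero by simp
qed

lemma face_coset_surj:
  assumes "u \<in> carrier face_ring"
  obtains p where "p \<in> carrier (mvpoly_ring X)" "u = face_coset p"
  using assms unfolding FactRing_def A_RCOSETS_def' by auto

lemma subfield_face_scalars:
  "subfield (range (\<lambda>c. face_coset (mvconst c))) (face_ring :: ('x, 'k::field) mvpoly set ring)"
proof -
  interpret ring_hom_ring "mvpoly_ring X" "face_ring :: ('x, 'k) mvpoly set ring" face_coset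
    by (rule face_coset_hom)
  \<comment> \<open>The coefficient at the monomial 0, whose support is the empty face, separates
    the two classes; this makes the quotient nontrivial.\<close>
  have "face_coset (1 :: ('x, 'k) mvpoly) \<noteq> face_coset 0"
    using empty_face by (subst nonface_coset_eq_iff) (auto simp: mvpoly_ring_carrier_closed intro!: exI[of _ 0])
  then have "\<one>\<^bsub>face_ring :: ('x, 'k) mvpoly set ring\<^esub> \<noteq> \<zero>\<^bsub>face_ring\<^esub>"
    using hom_one hom_zero by simp
  from img_is_subfield(2)[OF subfield_mvconst this] show ?thesis by (simp add: image_image)
qed

text \<open>Adjoin the monomials one by one. The class of a new one is outside the span of the
  earlier ones, since its own coefficient can be read off the class, so each line extension raises
  the dimension by 1.\<close>

lemma dimension_face_monomial_span:
  assumes "finite M" "M \<subseteq> {t. Poly_Mapping.keys t \<in> \<Delta>}"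
  shows "ring.dimension (face_ring :: ('x, 'k::field) mvpoly set ring) (card M)
    (range (\<lambda>c. face_coset (mvconst c))) (face_coset ` {p. Poly_Mapping.keys p \<subseteq> M})"
  using assms
proof (induction M rule: finite_induct)
  let ?A = "face_ring :: ('x, 'k) mvpoly set ring"
  interpret A: ring ?A using ideal.quotient_is_ring[OF ideal_nonface] .
  let ?K = "range (\<lambda>c. face_coset (mvconst c)) :: ('x, 'k) mvpoly set set"
  {
    case empty
    have "{p :: ('x, 'k) mvpoly. Poly_Mapping.keys p \<subseteq> {}} = {0}" by auto
    then show ?case using A.zero_dim by (simp add: face_coset_0)
  next
    case (insert t M)
    let ?m = "Poly_Mapping.single t 1 :: ('x, 'k) mvpoly"
    let ?W = "\<lambda>M. face_coset ` {p :: ('x, 'k) mvpoly. Poly_Mapping.keys p \<subseteq> M}"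
    have carr: "p \<in> carrier (mvpoly_ring X)" if "Poly_Mapping.keys p \<subseteq> insert t M"
      for p :: "('x, 'k) mvpoly"
      using that insert.prems face_subset unfolding mvpoly_ring_carrier_iff by blast
    have m: "?m \<in> carrier (mvpoly_ring X)" by (rule carr) simp
    have IH: "A.dimension (card M) ?K (?W M)" using insert by simp
    have notin: "face_coset ?m \<notin> ?W M"
    proof
      assume "face_coset ?m \<in> ?W M"
      then obtain p :: "('x, 'k) mvpoly" where p: "Poly_Mapping.keys p \<subseteq> M" "face_coset ?m = face_coset p"
        by blast
      then have "Poly_Mapping.lookup ?m t = Poly_Mapping.lookup p t"
        using nonface_coset_eq_iff[OF m carr[of p]] insert.prems by blast
      then have "t \<in> Poly_Mapping.keys p" by (simp add: in_keys_iff)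
      then show False using p(1) insert.hyps(2) by blast
    qed
    have step: "face_coset (mvconst c) \<otimes>\<^bsub>?A\<^esub> face_coset ?m \<oplus>\<^bsub>?A\<^esub> face_coset q =
        face_coset (Poly_Mapping.single t c + q)" if "Poly_Mapping.keys q \<subseteq> M" for c q
    proof -
      have "q \<in> carrier (mvpoly_ring X)" using carr that by blast
      then show ?thesis
        using face_coset_arith[OF mvpoly_ring_carrier_closed(6) m, of c]
          face_coset_arith(1)[OF mvpoly_ring_carrier_closed(5)[OF mvpoly_ring_carrier_closed(6) m], of q c]
        by (simp add: mvconst_def mult_single)
    qed
    have "?W (insert t M) = A.line_extension ?K (face_coset ?m) (?W M)"
    proof
      show "A.line_extension ?K (face_coset ?m) (?W M) \<subseteq> ?W (insert t M)"
      proof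
        fix u assume "u \<in> A.line_extension ?K (face_coset ?m) (?W M)"
        then obtain c q where cq: "Poly_Mapping.keys q \<subseteq> M" "u = face_coset (Poly_Mapping.single t c + q)"
          unfolding A.line_extension_mem_iff using step by auto
        have "Poly_Mapping.keys (Poly_Mapping.single t c + q) \<subseteq> insert t M"
          using keys_add[of "Poly_Mapping.single t c" q] cq(1) by (auto split: if_splits)
        then show "u \<in> ?W (insert t M)" using cq(2) by blast
      qed
      show "?W (insert t M) \<subseteq> A.line_extension ?K (face_coset ?m) (?W M)"
      proof
        fix u assume "u \<in> ?W (insert t M)"
        then obtain p where p: "Poly_Mapping.keys p \<subseteq> insert t M" "u = face_coset p" by blast
        define q where "q = p - Poly_Mapping.single t (Poly_Mapping.lookup p t)"
        have "Poly_Mapping.keys q \<subseteq> M"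
          using p(1) by (auto simp: q_def in_keys_iff lookup_minus lookup_single when_def split: if_splits)
        moreover have "u = face_coset (Poly_Mapping.single t (Poly_Mapping.lookup p t) + q)"
          using p(2) by (simp add: q_def)
        ultimately have "u = face_coset (mvconst (Poly_Mapping.lookup p t)) \<otimes>\<^bsub>?A\<^esub> face_coset ?m \<oplus>\<^bsub>?A\<^esub> face_coset q"
          "face_coset q \<in> ?W M"
          using step[of q] by auto
        then show "u \<in> A.line_extension ?K (face_coset ?m) (?W M)"
          unfolding A.line_extension_mem_iff by blast
      qed
    qed
    then show ?case
      using A.Suc_dim[OF face_coset_arith(3)[OF m m] notin IH] insert.hyps by simp
  }
qed

text \<open>Dropping the nonface terms of a homogeneous polynomial does not change its
  class.\<close>

lemma stanley_reisner_component_eq: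
  "stanley_reisner_component X \<Delta> i =
    face_coset ` {p :: ('x, 'k::field) mvpoly. Poly_Mapping.keys p \<subseteq> face_monomials i}"
proof -
  have "face_coset ` homogeneous_polys X i =
    face_coset ` {p :: ('x, 'k) mvpoly. Poly_Mapping.keys p \<subseteq> face_monomials i}"
  proof
    show "face_coset ` homogeneous_polys X i \<subseteq>
      face_coset ` {p :: ('x, 'k) mvpoly. Poly_Mapping.keys p \<subseteq> face_monomials i}"
    proof (rule image_subsetI)
      fix p :: "('x, 'k) mvpoly" assume p: "p \<in> homogeneous_polys X i"
      let ?q = "monomial_part {t. Poly_Mapping.keys t \<in> \<Delta>} p"
      have pc: "p \<in> carrier (mvpoly_ring X)" using p by (simp add: homogeneous_polys_def)
      then have "?q \<in> carrier (mvpoly_ring X)"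
        by (simp add: mvpoly_ring_carrier_iff keys_monomial_part)
      then have "face_coset p = face_coset ?q"
        using pc by (subst nonface_coset_eq_iff) (simp_all add: lookup_monomial_part)
      moreover have "Poly_Mapping.keys ?q \<subseteq> face_monomials i"
        using p by (auto simp: keys_monomial_part homogeneous_polys_def face_monomials_def monomial_degree_def)
      ultimately show "face_coset p \<in> face_coset ` {p. Poly_Mapping.keys p \<subseteq> face_monomials i}" by blast
    qed
    show "face_coset ` {p :: ('x, 'k) mvpoly. Poly_Mapping.keys p \<subseteq> face_monomials i} \<subseteq>
      face_coset ` homogeneous_polys X i"
      using face_subset
      by (intro image_mono) (auto simp: homogeneous_polys_def face_monomials_def
          mvpoly_ring_carrier_iff monomial_degree_def)
  qed
  then show ?thesis by (simp add: stanley_reisner_component_def stanley_reisner_ideal_eq)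
qed

lemma stanley_reisner_hilbert_function:
  "hilbert_function (stanley_reisner_ring X \<Delta> :: ('x, 'k::field) mvpoly set ring)
     (stanley_reisner_scalars X \<Delta>) (stanley_reisner_component X \<Delta>) i = card (face_monomials i)"
proof -
  interpret A: ring "face_ring :: ('x, 'k) mvpoly set ring"
    using ideal.quotient_is_ring[OF ideal_nonface] .
  have "face_monomials i \<subseteq> {t. Poly_Mapping.keys t \<in> \<Delta>}" by (auto simp: face_monomials_def)
  from A.dimI[OF subfield_face_scalars dimension_face_monomial_span[OF finite_face_monomials this]]
  show ?thesis
    by (simp add: hilbert_function_def stanley_reisner_ring_def stanley_reisner_scalars_def
        stanley_reisner_component_eq stanley_reisner_ideal_eq over_def)
qed

end

section \<open>Prime ideals and algebraic independence\<close>

text \<open>Values below \<open>D\<close> are digits in base \<open>D\<close>. The new position gets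
  weight 1 and the old weights are scaled by \<open>D\<close>; reduction mod \<open>D\<close> then
  isolates the new digit.\<close>

lemma kronecker_weights:
  fixes D :: nat
  assumes "finite G"
  shows "\<exists>c :: 'x \<Rightarrow> nat. \<forall>f g. (\<forall>x\<in>G. f x < D \<and> g x < D) \<longrightarrow>
    (\<Sum>x\<in>G. c x * f x) = (\<Sum>x\<in>G. c x * g x) \<longrightarrow> (\<forall>x\<in>G. f x = g x)"
  using assms
proof (induction G rule: finite_induct)
  case (insert y G)
  then obtain c where c: "\<And>f g. \<forall>x\<in>G. f x < D \<and> g x < D \<Longrightarrow>
      (\<Sum>x\<in>G. c x * f x) = (\<Sum>x\<in>G. c x * g x) \<Longrightarrow> \<forall>x\<in>G. f x = g x"
    by blast
  define c' where "c' = (\<lambda>x. if x = y then 1 else D * c x)"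
  have sum: "(\<Sum>x\<in>insert y G. c' x * f x) = f y + D * (\<Sum>x\<in>G. c x * f x)" for f
  proof -
    have "(\<Sum>x\<in>G. c' x * f x) = (\<Sum>x\<in>G. D * (c x * f x))"
      using insert.hyps by (intro sum.cong) (auto simp: c'_def)
    then show ?thesis using insert.hyps by (simp add: c'_def sum_distrib_left)
  qed
  show ?case
  proof (rule exI[of _ c'], intro allI impI)
    fix f g assume lt: "\<forall>x\<in>insert y G. f x < D \<and> g x < D"
      and "(\<Sum>x\<in>insert y G. c' x * f x) = (\<Sum>x\<in>insert y G. c' x * g x)"
    then have eq: "f y + D * (\<Sum>x\<in>G. c x * f x) = g y + D * (\<Sum>x\<in>G. c x * g x)"
      by (simp add: sum)
    then have "(f y + D * (\<Sum>x\<in>G. c x * f x)) mod D = (g y + D * (\<Sum>x\<in>G. c x * g x)) mod D"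
      by (rule arg_cong)
    then have y: "f y = g y" using lt by simp
    then have "(\<Sum>x\<in>G. c x * f x) = (\<Sum>x\<in>G. c x * g x)" using eq lt by auto
    then show "\<forall>x\<in>insert y G. f x = g x" using c[of f g] lt y by blast
  qed
qed simp

text \<open>Such a weight (Kronecker substitution) stands in for a monomial order, which is not
  available because the variables carry no order.\<close>

lemma additive_injective_weight:
  assumes "finite G" "finite M" "\<And>t. t \<in> M \<Longrightarrow> Poly_Mapping.keys t \<subseteq> G"
  shows "\<exists>w :: ('x \<Rightarrow>\<^sub>0 nat) \<Rightarrow> nat. (\<forall>s t. w (s + t) = w s + w t) \<and> inj_on w M"
proof -
  \<comment> \<open>The sum of all degrees bounds every single exponent, so the exponents are digits
    in base \<open>D\<close>.\<close>
  define D where "D = Suc (\<Sum>t\<in>M. monomial_degree t)"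
  have lt: "Poly_Mapping.lookup t x < D" if "t \<in> M" "x \<in> G" for t x
  proof -
    have "Poly_Mapping.lookup t x \<le> monomial_degree t"
      using monomial_degree_superset[OF assms(1) assms(3)[OF that(1)]] that(2) assms(1)
      by (simp add: member_le_sum)
    also have "\<dots> \<le> (\<Sum>t\<in>M. monomial_degree t)"
      using that(1) assms(2) by (simp add: member_le_sum)
    finally show ?thesis by (simp add: D_def)
  qed
  obtain c :: "'x \<Rightarrow> nat" where c: "\<And>f g. \<forall>x\<in>G. f x < D \<and> g x < D \<Longrightarrow>
      (\<Sum>x\<in>G. c x * f x) = (\<Sum>x\<in>G. c x * g x) \<Longrightarrow> \<forall>x\<in>G. f x = g x"
    using kronecker_weights[OF assms(1), of D] by blast
  define w where "w = (\<lambda>t. \<Sum>x\<in>G. c x * Poly_Mapping.lookup t x)"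
  have "w (s + t) = w s + w t" for s t
    by (simp add: w_def lookup_add algebra_simps sum.distrib)
  moreover have "inj_on w M"
  proof (rule inj_onI)
    fix s t assume st: "s \<in> M" "t \<in> M" "w s = w t"
    have G: "\<forall>x\<in>G. Poly_Mapping.lookup s x = Poly_Mapping.lookup t x"
      using c[of "Poly_Mapping.lookup s" "Poly_Mapping.lookup t"] lt st unfolding w_def by blast
    have "Poly_Mapping.lookup s x = Poly_Mapping.lookup t x" for x
    proof (cases "x \<in> G")
      case False
      then have "x \<notin> Poly_Mapping.keys s" "x \<notin> Poly_Mapping.keys t" using assms(3) st by blast+
      then show ?thesis by (simp add: in_keys_iff)
    qed (use G in blast)
    then show "s = t" by (rule poly_mapping_eqI)
  qed
  ultimately show ?thesis by blast
qed

text \<open>Only terms in the variables of \<open>G\<close> matter modulo this ideal. If both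
  factors have such terms, the product of their heaviest ones under an injective additive weight
  cannot cancel.\<close>

lemma primeideal_nonface_polys_Pow:
  assumes "finite G"
  shows "primeideal (nonface_polys X (Pow G)) (mvpoly_ring X :: ('x, 'k::field) mvpoly ring)"
proof (rule primeidealI)
  let ?J = "nonface_polys X (Pow G) :: ('x, 'k) mvpoly set"
  show "ideal ?J (mvpoly_ring X)" by (rule ideal_nonface_polys) auto
  show "cring (mvpoly_ring X :: ('x, 'k) mvpoly ring)" by (rule cring_mvpoly_ring)
  have "1 \<notin> ?J" by (simp add: nonface_polys_def)
  then show "carrier (mvpoly_ring X) \<noteq> ?J" using mvpoly_ring_carrier_closed(2) by blast
  fix p q :: "('x, 'k) mvpoly"
  assume pq: "p \<in> carrier (mvpoly_ring X)" "q \<in> carrier (mvpoly_ring X)"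
    "p \<otimes>\<^bsub>mvpoly_ring X\<^esub> q \<in> ?J"
  show "p \<in> ?J \<or> q \<in> ?J"
  proof (rule ccontr)
    assume n: "\<not> (p \<in> ?J \<or> q \<in> ?J)"
    define A where "A = {t \<in> Poly_Mapping.keys p. Poly_Mapping.keys t \<subseteq> G}"
    define B where "B = {t \<in> Poly_Mapping.keys q. Poly_Mapping.keys t \<subseteq> G}"
    have fin: "finite A" "finite B" by (simp_all add: A_def B_def)
    have ne: "A \<noteq> {}" "B \<noteq> {}"
      using n pq(1,2) by (auto simp: nonface_polys_def A_def B_def)
    obtain w :: "('x \<Rightarrow>\<^sub>0 nat) \<Rightarrow> nat" where w: "\<And>s t. w (s + t) = w s + w t" "inj_on w (A \<union> B)"
    proof -
      have "Poly_Mapping.keys t \<subseteq> G" if "t \<in> A \<union> B" for t using that by (auto simp: A_def B_def)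
      then have "\<exists>w :: ('x \<Rightarrow>\<^sub>0 nat) \<Rightarrow> nat. (\<forall>s t. w (s + t) = w s + w t) \<and> inj_on w (A \<union> B)"
        using fin by (intro additive_injective_weight[OF assms]) simp_all
      then show ?thesis using that by blast
    qed
    obtain a where a: "a \<in> A" "\<And>s. s \<in> A \<Longrightarrow> w s \<le> w a"
      using Max_in[of "w ` A"] Max_ge[of "w ` A"] fin(1) ne(1) by fastforce
    obtain b where b: "b \<in> B" "\<And>s. s \<in> B \<Longrightarrow> w s \<le> w b"
      using Max_in[of "w ` B"] Max_ge[of "w ` B"] fin(2) ne(2) by fastforce
    \<comment> \<open>A factorization of \<open>a + b\<close> again has its parts supported in
      \<open>G\<close>; maximality forces equal weights, and injectivity equal monomials.\<close>
    have uniq: "s = a \<and> u = b"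
      if "s \<in> Poly_Mapping.keys p" "u \<in> Poly_Mapping.keys q" "s + u = a + b" for s u
    proof -
      have "Poly_Mapping.keys (s + u) \<subseteq> G" using that(3) a(1) b(1) by (simp add: A_def B_def)
      then have su: "s \<in> A" "u \<in> B" using that(1,2) by (simp_all add: A_def B_def)
      have "w s + w u = w a + w b" using that(3) w(1) by metis
      then have "w s = w a" "w u = w b" using a(2)[OF su(1)] b(2)[OF su(2)] by linarith+
      then show ?thesis using w(2) su a(1) b(1) by (auto dest: inj_onD)
    qed
    let ?c = "\<lambda>s u. Poly_Mapping.lookup p s * Poly_Mapping.lookup q u"
    have ab: "a \<in> Poly_Mapping.keys p" "b \<in> Poly_Mapping.keys q" using a b by (simp_all add: A_def B_def)
    have "Poly_Mapping.lookup (p * q) (a + b) =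
        (\<Sum>s\<in>Poly_Mapping.keys p. \<Sum>u\<in>Poly_Mapping.keys q. if s = a then if u = b then ?c a b else 0 else 0)"
      unfolding lookup_times_sum_keys
      by (intro sum.cong refl) (use uniq in \<open>auto simp: when_def\<close>)
    also have "\<dots> = (\<Sum>s\<in>Poly_Mapping.keys p. if s = a then ?c a b else 0)"
      using ab(2) by (intro sum.cong) auto
    also have "\<dots> = ?c a b" using ab(1) by simp
    finally have "a + b \<in> Poly_Mapping.keys (p * q)" using ab by (simp add: in_keys_iff)
    moreover have "Poly_Mapping.keys (a + b) \<subseteq> G" using a(1) b(1) by (simp add: A_def B_def)
    moreover have "\<forall>t\<in>Poly_Mapping.keys (p * q). Poly_Mapping.keys t \<notin> Pow G"
      using pq(3) by (simp add: nonface_polys_def)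
    ultimately show False by blast
  qed
qed

text \<open>Gaussian elimination: solve equation \<open>t\<close> for the unknown at a pivot
  \<open>a\<close>, substitute it into the other equations, and solve the smaller system by
  induction.\<close>

lemma homogeneous_linear_system:
  fixes g :: "'a \<Rightarrow> 'b \<Rightarrow> 'k::field"
  assumes "finite B" "finite A" "card B < card A"
  shows "\<exists>c. (\<exists>\<alpha>\<in>A. c \<alpha> \<noteq> 0) \<and> (\<forall>t\<in>B. (\<Sum>\<alpha>\<in>A. c \<alpha> * g \<alpha> t) = 0)"
  using assms
proof (induction B arbitrary: A g rule: finite_induct)
  case empty
  then have "A \<noteq> {}" by auto
  then show ?case by (intro exI[of _ "\<lambda>_. 1"]) auto
next
  case (insert t B)
  show ?case
  proof (cases "\<forall>\<alpha>\<in>A. g \<alpha> t = 0")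
    case True
    obtain c where "\<exists>\<alpha>\<in>A. c \<alpha> \<noteq> 0" "\<forall>s\<in>B. (\<Sum>\<alpha>\<in>A. c \<alpha> * g \<alpha> s) = 0"
      using insert.IH[of A g] insert.prems insert.hyps by auto
    then show ?thesis using True by (intro exI[of _ c]) auto
  next
    case False
    then obtain a where a: "a \<in> A" "g a t \<noteq> 0" by blast
    let ?A = "A - {a}"
    have "card B < card ?A" using insert.prems insert.hyps a(1) by simp
    then obtain c where c: "\<exists>\<alpha>\<in>?A. c \<alpha> \<noteq> 0"
      "\<And>s. s \<in> B \<Longrightarrow> (\<Sum>\<alpha>\<in>?A. c \<alpha> * (g \<alpha> s - g \<alpha> t / g a t * g a s)) = 0"
      using insert.IH[of ?A "\<lambda>\<alpha> s. g \<alpha> s - g \<alpha> t / g a t * g a s"] insert.prems by auto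
    \<comment> \<open>The value at \<open>a\<close> is the one that makes equation \<open>t\<close>
      hold.\<close>
    define c' where "c' = c(a := - (\<Sum>\<alpha>\<in>?A. c \<alpha> * g \<alpha> t) / g a t)"
    have split: "(\<Sum>\<alpha>\<in>A. c' \<alpha> * g \<alpha> s) =
        (\<Sum>\<alpha>\<in>?A. c \<alpha> * g \<alpha> s) - (\<Sum>\<alpha>\<in>?A. c \<alpha> * g \<alpha> t) / g a t * g a s" for s
    proof -
      have "(\<Sum>\<alpha>\<in>A. c' \<alpha> * g \<alpha> s) = c' a * g a s + (\<Sum>\<alpha>\<in>?A. c' \<alpha> * g \<alpha> s)"
        using insert.prems(1) a(1) by (rule sum.remove)
      also have "(\<Sum>\<alpha>\<in>?A. c' \<alpha> * g \<alpha> s) = (\<Sum>\<alpha>\<in>?A. c \<alpha> * g \<alpha> s)"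
        by (intro sum.cong) (auto simp: c'_def)
      finally show ?thesis by (simp add: c'_def)
    qed
    have "(\<Sum>\<alpha>\<in>A. c' \<alpha> * g \<alpha> s) = 0" if "s \<in> insert t B" for s
    proof (cases "s = t")
      case True
      then show ?thesis using a(2) by (simp add: split)
    next
      case False
      then have "(\<Sum>\<alpha>\<in>?A. c \<alpha> * (g \<alpha> s - g \<alpha> t / g a t * g a s)) = 0" using c(2) that by simp
      then show ?thesis unfolding split
        by (simp add: algebra_simps sum_subtractf sum_distrib_left sum_divide_distrib)
    qed
    moreover have "\<exists>\<alpha>\<in>A. c' \<alpha> \<noteq> 0" using c(1) by (auto simp: c'_def)
    ultimately show ?thesis by blast
  qed
qed

text \<open>The monomial in the elements \<open>as\<close> with exponent vector
  \<open>\<alpha>\<close>. Since \<open>map2\<close> truncates to the shorter list, exponent lists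
  are kept at the length of \<open>as\<close>.\<close>

definition power_product :: "('x, 'k::field) mvpoly list \<Rightarrow> nat list \<Rightarrow> ('x, 'k) mvpoly" where
  "power_product as \<alpha> = prod_list (map2 (^) as \<alpha>)"

lemma power_product_simps [simp]:
  "power_product [] \<alpha> = 1" "power_product (a # as) (e # \<alpha>) = a ^ e * power_product as \<alpha>"
  by (simp_all add: power_product_def)

lemma power_product_closed:
  "set as \<subseteq> carrier (mvpoly_ring X) \<Longrightarrow> length \<alpha> = length as \<Longrightarrow>
    power_product as \<alpha> \<in> carrier (mvpoly_ring X)"
  by (induction as arbitrary: \<alpha>)
    (auto simp: length_Suc_conv mvpoly_ring_carrier_closed mvpoly_ring_power_closed)

lemma primeideal_power_notin:
  assumes "primeideal P (mvpoly_ring X)" "a \<in> carrier (mvpoly_ring X)" "a \<notin> P"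
  shows "a ^ e \<notin> P"
proof -
  interpret primeideal P "mvpoly_ring X" by (rule assms(1))
  show ?thesis
  proof (induction e)
    case 0
    have "\<one>\<^bsub>mvpoly_ring X\<^esub> \<notin> P" using one_imp_carrier I_notcarr by blast
    then show ?case by simp
  next
    case (Suc e)
    then show ?case
      using I_prime[OF assms(2) mvpoly_ring_power_closed[OF assms(2)], of e] assms(3) by auto
  qed
qed

text \<open>Divide out the least power of the first element, pass to the next prime (which contains that
  element), and induct: elements in the gaps of the chain are algebraically independent.\<close>

lemma prime_chain_independent:
  fixes as :: "('x, 'k::field) mvpoly list"
  assumes "\<And>i. i \<le> length as \<Longrightarrow> primeideal (Q i) (mvpoly_ring X)"
    and "\<And>i. i < length as \<Longrightarrow> Q i \<subseteq> Q (Suc i)"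
    and "\<And>i. i < length as \<Longrightarrow> as ! i \<in> Q (Suc i) - Q i"
    and "finite A" "A \<noteq> {}" "\<And>\<alpha>. \<alpha> \<in> A \<Longrightarrow> length \<alpha> = length as \<and> c \<alpha> \<noteq> 0"
  shows "(\<Sum>\<alpha>\<in>A. mvconst (c \<alpha>) * power_product as \<alpha>) \<notin> Q 0"
  using assms
proof (induction as arbitrary: Q A c)
  case Nil
  interpret P: primeideal "Q 0" "mvpoly_ring X" using Nil.prems(1) by simp
  have "\<And>\<alpha>. \<alpha> \<in> A \<Longrightarrow> \<alpha> = []" using Nil.prems(6) by auto
  \<comment> \<open>With no elements left the sum is a single nonzero constant, a unit, which no
    prime contains.\<close>
  then have A: "A = {[]}" using Nil.prems(5) by blast
  show ?case
  proof
    assume "(\<Sum>\<alpha>\<in>A. mvconst (c \<alpha>) * power_product [] \<alpha>) \<in> Q 0"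
    then have "mvconst (c []) \<in> Q 0" by (simp add: A)
    from P.I_l_closed[OF this mvpoly_ring_carrier_closed(6)[of "inverse (c [])"]]
    have "(1 :: ('x, 'k) mvpoly) \<in> Q 0" using Nil.prems(6)[of "[]"] A by (simp add: mvconst_def mult_single)
    then show False using P.one_imp_carrier P.I_notcarr by simp
  qed
next
  case (Cons a as)
  interpret P0: primeideal "Q 0" "mvpoly_ring X" using Cons.prems(1) by simp
  interpret P1: primeideal "Q (Suc 0)" "mvpoly_ring X" using Cons.prems(1) by simp
  have mem: "(a # as) ! i \<in> carrier (mvpoly_ring X)" if "i < length (a # as)" for i
  proof -
    interpret P: primeideal "Q (Suc i)" "mvpoly_ring X" using Cons.prems(1)[of "Suc i"] that by simp
    show ?thesis using Cons.prems(3)[OF that] P.Icarr by blast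
  qed
  have carr: "a \<in> carrier (mvpoly_ring X)" "set as \<subseteq> carrier (mvpoly_ring X)"
    using mem[of 0] mem[of "Suc i" for i] by (auto simp: in_set_conv_nth)
  have a: "a \<notin> Q 0" "a \<in> Q (Suc 0)" using Cons.prems(3)[of 0] by auto
  define e where "e = Min (hd ` A)"
  have e: "e \<in> hd ` A" "\<And>\<alpha>. \<alpha> \<in> A \<Longrightarrow> e \<le> hd \<alpha>"
    using Cons.prems(4,5) unfolding e_def by auto
  have cons: "\<alpha> = hd \<alpha> # tl \<alpha>" "length (tl \<alpha>) = length as" if "\<alpha> \<in> A" for \<alpha>
    using Cons.prems(6)[OF that] by (cases \<alpha>; simp)+
  \<comment> \<open>\<open>A0\<close> collects the exponent vectors with the least power of
    \<open>a\<close>. After division by \<open>a ^ e\<close> the terms are \<open>r\<close>; off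
    \<open>A0\<close> they still contain \<open>a\<close>, and \<open>r'\<close> is \<open>r\<close>
    with one such factor removed.\<close>
  define A0 where "A0 = {\<alpha> \<in> A. hd \<alpha> = e}"
  define r where "r = (\<lambda>\<alpha>. mvconst (c \<alpha>) * a ^ (hd \<alpha> - e) * power_product as (tl \<alpha>))"
  define r' where "r' = (\<lambda>\<alpha>. mvconst (c \<alpha>) * a ^ (hd \<alpha> - e - 1) * power_product as (tl \<alpha>))"
  have rc: "r \<alpha> \<in> carrier (mvpoly_ring X)" "r' \<alpha> \<in> carrier (mvpoly_ring X)" if "\<alpha> \<in> A" for \<alpha>
    unfolding r_def r'_def using carr cons(2)[OF that]
    by (intro mvpoly_ring_carrier_closed mvpoly_ring_power_closed power_product_closed; simp)+
  \<comment> \<open>On \<open>A0\<close> no factor \<open>a\<close> is left, so the induction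
    hypothesis applies to the remaining elements and the chain starting at
    \<open>Q (Suc 0)\<close>.\<close>
  have g: "sum r A0 \<notin> Q (Suc 0)"
  proof -
    have "(\<Sum>\<beta>\<in>tl ` A0. mvconst (c (e # \<beta>)) * power_product as \<beta>) \<notin> Q (Suc 0)"
    proof (rule Cons.IH[of "\<lambda>i. Q (Suc i)"])
      show "finite (tl ` A0)" "tl ` A0 \<noteq> {}" using Cons.prems(4) e(1) by (auto simp: A0_def)
      show "length \<beta> = length as \<and> c (e # \<beta>) \<noteq> 0" if \<beta>: "\<beta> \<in> tl ` A0" for \<beta>
      proof -
        obtain \<alpha> where "\<alpha> \<in> A" "hd \<alpha> = e" "\<beta> = tl \<alpha>" using \<beta> by (auto simp: A0_def)
        then show ?thesis using cons[of \<alpha>] Cons.prems(6)[of \<alpha>] by metis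
      qed
    qed (use Cons.prems(1-3)[of "Suc i" for i] in auto)
    moreover have "(\<Sum>\<beta>\<in>tl ` A0. mvconst (c (e # \<beta>)) * power_product as \<beta>) = sum r A0"
    proof (subst sum.reindex)
      show "inj_on tl A0"
        using cons(1) by (intro inj_onI) (metis (mono_tags, lifting) A0_def mem_Collect_eq)
      show "sum ((\<lambda>\<beta>. mvconst (c (e # \<beta>)) * power_product as \<beta>) \<circ> tl) A0 = sum r A0"
      proof (rule sum.cong)
        fix \<alpha> assume "\<alpha> \<in> A0"
        then have "e # tl \<alpha> = \<alpha>" "hd \<alpha> = e" using cons(1)[of \<alpha>] by (auto simp: A0_def)
        then show "((\<lambda>\<beta>. mvconst (c (e # \<beta>)) * power_product as \<beta>) \<circ> tl) \<alpha> = r \<alpha>"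
          by (simp add: r_def)
      qed simp
    qed
    ultimately show ?thesis by simp
  qed
  show ?case
  proof
    assume in0: "(\<Sum>\<alpha>\<in>A. mvconst (c \<alpha>) * power_product (a # as) \<alpha>) \<in> Q 0"
    have "(\<Sum>\<alpha>\<in>A. mvconst (c \<alpha>) * power_product (a # as) \<alpha>) = a ^ e * sum r A"
      unfolding sum_distrib_left
    proof (rule sum.cong)
      fix \<alpha> assume \<alpha>: "\<alpha> \<in> A"
      have "power_product (a # as) \<alpha> = a ^ hd \<alpha> * power_product as (tl \<alpha>)"
        using cons(1)[OF \<alpha>] power_product_simps(2) by metis
      moreover have "a ^ hd \<alpha> = a ^ e * a ^ (hd \<alpha> - e)" using e(2)[OF \<alpha>] by (simp flip: power_add)
      ultimately show "mvconst (c \<alpha>) * power_product (a # as) \<alpha> = a ^ e * r \<alpha>"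
        by (simp add: r_def mult_ac)
    qed simp
    then have "a ^ e * sum r A \<in> Q 0" using in0 by simp
    \<comment> \<open>The factor \<open>a ^ e\<close> cancels because \<open>Q 0\<close> is prime
      and does not contain \<open>a\<close>.\<close>
    then have "sum r A \<in> Q 0"
      using P0.I_prime[OF mvpoly_ring_power_closed[OF carr(1)] mvpoly_ring_sum_closed[of A r], of e] rc
        primeideal_power_notin[OF P0.primeideal_axioms carr(1) a(1)] by auto
    then have in1: "sum r A \<in> Q (Suc 0)" using Cons.prems(2)[of 0] by auto
    \<comment> \<open>These terms lie in \<open>Q (Suc 0)\<close> through their factor
      \<open>a\<close>; subtracting them would put \<open>sum r A0\<close> there as well.\<close>
    have "sum r (A - A0) = a * sum r' (A - A0)"
      unfolding sum_distrib_left
    proof (rule sum.cong)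
      fix \<alpha> assume \<alpha>: "\<alpha> \<in> A - A0"
      then have "hd \<alpha> - e = Suc (hd \<alpha> - e - 1)" using e(2)[of \<alpha>] by (auto simp: A0_def)
      then have "a ^ (hd \<alpha> - e) = a * a ^ (hd \<alpha> - e - 1)" by (metis power_Suc)
      then show "r \<alpha> = a * r' \<alpha>" by (simp add: r_def r'_def mult_ac)
    qed simp
    moreover have "sum r' (A - A0) \<in> carrier (mvpoly_ring X)"
      by (rule mvpoly_ring_sum_closed) (use rc in auto)
    ultimately have "sum r (A - A0) \<in> Q (Suc 0)" using P1.I_r_closed[OF a(2)] by simp
    moreover have "sum r A = sum r (A - A0) + sum r A0"
      using Cons.prems(4) by (intro sum.subset_diff) (auto simp: A0_def)
    moreover have "- sum r (A - A0) \<in> Q (Suc 0)"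
      using P1.a_inv_closed[OF calculation(1)] mvpoly_ring_uminus[of "sum r (A - A0)" X]
        P1.Icarr[OF calculation(1)] by simp
    ultimately have "sum r A0 \<in> Q (Suc 0)"
      using P1.a_closed[OF in1, of "- sum r (A - A0)"] by simp
    then show False using g by simp
  qed
qed

section \<open>Krull dimension of Stanley-Reisner rings\<close>

text \<open>Degrees add under multiplication. The bound confines power products with bounded
  exponents to finitely many monomials modulo the ideal.\<close>

lemma degree_bound_power_product:
  fixes as :: "('x, 'k::field) mvpoly list"
  assumes "\<And>a t. a \<in> set as \<Longrightarrow> t \<in> Poly_Mapping.keys a \<Longrightarrow> monomial_degree t \<le> D"
    and "length \<alpha> = length as" "t \<in> Poly_Mapping.keys (power_product as \<alpha>)"
  shows "monomial_degree t \<le> D * sum_list \<alpha>"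
  using assms
proof (induction as arbitrary: \<alpha> t)
  case Nil
  then show ?case by (simp add: monomial_degree_def)
next
  case (Cons a as)
  then obtain e \<beta> where \<alpha>: "\<alpha> = e # \<beta>" "length \<beta> = length as" by (auto simp: length_Suc_conv)
  have pow: "monomial_degree u \<le> D * k" if "u \<in> Poly_Mapping.keys (a ^ k)" for u k
    using that
  proof (induction k arbitrary: u)
    case 0
    then show ?case by (simp add: monomial_degree_def)
  next
    case (Suc k)
    then obtain s v where sv: "u = s + v" "s \<in> Poly_Mapping.keys a" "v \<in> Poly_Mapping.keys (a ^ k)"
      using keys_mult[of a "a ^ k"] by auto
    then show ?case
      using Suc.IH[OF sv(3)] Cons.prems(1)[of a s] by (simp add: monomial_degree_add)
  qed
  obtain u v where uv: "t = u + v" "u \<in> Poly_Mapping.keys (a ^ e)" "v \<in> Poly_Mapping.keys (power_product as \<beta>)"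
    using Cons.prems(3) keys_mult[of "a ^ e" "power_product as \<beta>"] \<alpha> by auto
  have "monomial_degree v \<le> D * sum_list \<beta>"
    by (rule Cons.IH[OF _ \<alpha>(2) uv(3)]) (use Cons.prems(1) in auto)
  then show ?case using pow[OF uv(2)] uv(1) \<alpha> by (simp add: monomial_degree_add distrib_left)
qed

lemma lookup_mvconst_times:
  "Poly_Mapping.lookup (mvconst c * p) t = c * Poly_Mapping.lookup p t"
  unfolding lookup_times_sum_keys
  by (cases "c = 0") (auto simp: mvconst_def when_def in_keys_iff)

text \<open>Such a monomial is determined by its exponents on \<open>F\<close>, each at most
  \<open>L\<close>. This crude count has the right order of growth in \<open>L\<close>.\<close>

lemma card_support_degree_le:
  assumes "finite F"
  shows "finite {t. Poly_Mapping.keys t = F \<and> monomial_degree t \<le> L}"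
    "card {t. Poly_Mapping.keys t = F \<and> monomial_degree t \<le> L} \<le> (L + 1) ^ card F"
proof -
  let ?S = "{t. Poly_Mapping.keys t = F \<and> monomial_degree t \<le> L}"
  let ?f = "\<lambda>t. restrict (Poly_Mapping.lookup t) F"
  have inj: "inj_on ?f ?S"
  proof (rule inj_onI, rule poly_mapping_eqI)
    fix s t x assume st: "s \<in> ?S" "t \<in> ?S" "?f s = ?f t"
    show "Poly_Mapping.lookup s x = Poly_Mapping.lookup t x"
    proof (cases "x \<in> F")
      case True
      then show ?thesis using fun_cong[OF st(3), of x] by simp
    next
      case False
      then have "x \<notin> Poly_Mapping.keys s" "x \<notin> Poly_Mapping.keys t" using st by auto
      then show ?thesis by (simp add: in_keys_iff)
    qed
  qed
  have sub: "?f ` ?S \<subseteq> (\<Pi>\<^sub>E x\<in>F. {..L})"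
  proof (rule image_subsetI)
    fix t assume t: "t \<in> ?S"
    have "Poly_Mapping.lookup t x \<le> L" if "x \<in> F" for x
    proof -
      have "Poly_Mapping.lookup t x \<le> monomial_degree t"
        using t that assms by (simp add: monomial_degree_superset[of F] member_le_sum)
      then show ?thesis using t by simp
    qed
    then show "?f t \<in> (\<Pi>\<^sub>E x\<in>F. {..L})" by auto
  qed
  have fin: "finite (\<Pi>\<^sub>E x\<in>F. {..L})" using assms by (intro finite_PiE) auto
  show "finite ?S" by (rule finite_imageD[OF finite_subset[OF sub fin] inj])
  have "card ?S \<le> card (\<Pi>\<^sub>E x\<in>F. {..L})" by (rule card_inj_on_le[OF inj sub fin])
  then show "card ?S \<le> (L + 1) ^ card F" using assms by (simp add: card_PiE)
qed

section \<open>Comparison of prime chains with face sizes\<close>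

context simplicial_complex
begin

lemma card_face_monomials_le:
  assumes "\<And>F. F \<in> \<Delta> \<Longrightarrow> card F \<le> d"
  shows "finite {t. Poly_Mapping.keys t \<in> \<Delta> \<and> monomial_degree t \<le> L}"
    "card {t. Poly_Mapping.keys t \<in> \<Delta> \<and> monomial_degree t \<le> L} \<le> card \<Delta> * (L + 1) ^ d"
proof -
  let ?S = "\<lambda>F. {t. Poly_Mapping.keys t = F \<and> monomial_degree t \<le> L}"
  have eq: "{t. Poly_Mapping.keys t \<in> \<Delta> \<and> monomial_degree t \<le> L} = (\<Union>F\<in>\<Delta>. ?S F)" by auto
  show "finite {t. Poly_Mapping.keys t \<in> \<Delta> \<and> monomial_degree t \<le> L}"
    unfolding eq using finite_complex card_support_degree_le(1) finite_face by blast
  have "card (\<Union>F\<in>\<Delta>. ?S F) \<le> (\<Sum>F\<in>\<Delta>. card (?S F))"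
    using finite_complex by (rule card_UN_le)
  also have "\<dots> \<le> (\<Sum>F\<in>\<Delta>. (L + 1) ^ d)"
  proof (rule sum_mono)
    fix F assume F: "F \<in> \<Delta>"
    have "card (?S F) \<le> (L + 1) ^ card F" by (rule card_support_degree_le(2)[OF finite_face[OF F]])
    also have "\<dots> \<le> (L + 1) ^ d" using assms[OF F] by (intro power_increasing) auto
    finally show "card (?S F) \<le> (L + 1) ^ d" .
  qed
  finally show "card {t. Poly_Mapping.keys t \<in> \<Delta> \<and> monomial_degree t \<le> L} \<le> card \<Delta> * (L + 1) ^ d"
    unfolding eq by simp
qed

text \<open>There are \<open>(N + 1) ^ (d + 1)\<close> power products with exponents at most \<open>N\<close>, but modulo the
  ideal they lie in a space whose dimension is only of order \<open>N ^ d\<close>.\<close>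

lemma face_ring_dependent:
  fixes as :: "('x, 'k::field) mvpoly list"
  assumes "\<And>F. F \<in> \<Delta> \<Longrightarrow> card F \<le> d" "length as = Suc d" "set as \<subseteq> carrier (mvpoly_ring X)"
  obtains A c where "finite A" "A \<noteq> {}" "\<And>\<alpha>. \<alpha> \<in> A \<Longrightarrow> length \<alpha> = length as \<and> c \<alpha> \<noteq> 0"
    "(\<Sum>\<alpha>\<in>A. mvconst (c \<alpha>) * power_product as \<alpha>) \<in> nonface_polys X \<Delta>"
proof -
  define D where "D = (\<Sum>a\<in>set as. \<Sum>t\<in>Poly_Mapping.keys a. monomial_degree t)"
  have D: "monomial_degree t \<le> D" if "a \<in> set as" "t \<in> Poly_Mapping.keys a" for a t
  proof -
    have "monomial_degree t \<le> (\<Sum>t\<in>Poly_Mapping.keys a. monomial_degree t)"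
      using that(2) by (simp add: member_le_sum)
    also have "\<dots> \<le> D" unfolding D_def using that(1)
      by (intro member_le_sum[of a "set as" "\<lambda>a. \<Sum>t\<in>Poly_Mapping.keys a. monomial_degree t"]) auto
    finally show ?thesis .
  qed
  \<comment> \<open>The constants give \<open>L + 1 \<le> K * (N + 1)\<close> and
    \<open>card \<Delta> * K ^ d = N\<close>, so there are at most \<open>N * (N + 1) ^ d\<close>
    face monomials of degree up to \<open>L\<close>, fewer than the \<open>(N + 1) ^ Suc d\<close>
    exponent vectors.\<close>
  define K where "K = D * Suc d + 1"
  define N where "N = card \<Delta> * K ^ d"
  define L where "L = D * (Suc d * N)"
  define A where "A = {\<alpha>. set \<alpha> \<subseteq> {..N} \<and> length \<alpha> = Suc d}"
  define B where "B = {t. Poly_Mapping.keys t \<in> \<Delta> \<and> monomial_degree t \<le> L}"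
  have finA: "finite A" unfolding A_def by (rule finite_lists_length_eq) simp
  have cardA: "card A = (N + 1) ^ Suc d" unfolding A_def by (subst card_lists_length_eq) simp_all
  have "card B \<le> card \<Delta> * (L + 1) ^ d"
    unfolding B_def by (rule card_face_monomials_le(2)[OF assms(1)])
  also have "\<dots> \<le> card \<Delta> * (K * (N + 1)) ^ d"
    by (intro mult_left_mono power_mono) (simp_all add: L_def K_def algebra_simps)
  also have "\<dots> = N * (N + 1) ^ d" by (simp only: power_mult_distrib) (simp add: N_def mult.assoc)
  also have "\<dots> < (N + 1) ^ Suc d" by simp
  finally have "card B < card A" using cardA by simp
  moreover have "finite B" unfolding B_def by (rule card_face_monomials_le(1)[OF assms(1)])
  \<comment> \<open>One unknown per exponent vector and one equation per monomial in
    \<open>B\<close>.\<close>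
  ultimately obtain c :: "nat list \<Rightarrow> 'k" where c: "\<exists>\<alpha>\<in>A. c \<alpha> \<noteq> 0"
    "\<And>t. t \<in> B \<Longrightarrow> (\<Sum>\<alpha>\<in>A. c \<alpha> * Poly_Mapping.lookup (power_product as \<alpha>) t) = 0"
    using homogeneous_linear_system[of B A "\<lambda>\<alpha> t. Poly_Mapping.lookup (power_product as \<alpha>) t"] finA
    by blast
  let ?p = "\<lambda>A. \<Sum>\<alpha>\<in>A. mvconst (c \<alpha>) * power_product as \<alpha>"
  have lk: "Poly_Mapping.lookup (?p A) t = 0" if t: "Poly_Mapping.keys t \<in> \<Delta>" for t
  proof (cases "t \<in> B")
    case True
    then show ?thesis using c(2)[OF True] by (simp add: lookup_sum lookup_mvconst_times)
  next
    case False
    \<comment> \<open>A face monomial outside \<open>B\<close> has degree above \<open>L\<close>,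
      too high for any of the power products.\<close>
    have "Poly_Mapping.lookup (power_product as \<alpha>) t = 0" if \<alpha>: "\<alpha> \<in> A" for \<alpha>
    proof (rule ccontr)
      assume "Poly_Mapping.lookup (power_product as \<alpha>) t \<noteq> 0"
      then have "t \<in> Poly_Mapping.keys (power_product as \<alpha>)" by (simp add: in_keys_iff)
      then have "monomial_degree t \<le> D * sum_list \<alpha>"
        using \<alpha> assms(2) D by (intro degree_bound_power_product[of as]) (auto simp: A_def)
      also have "sum_list \<alpha> \<le> Suc d * N"
      proof -
        have "sum_list \<alpha> \<le> length \<alpha> * N"
          using \<alpha> sum_list_mono[of \<alpha> "\<lambda>x. x" "\<lambda>_. N"] by (auto simp: A_def sum_list_triv)
        then show ?thesis using \<alpha> by (simp add: A_def)
      qed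
      finally have "monomial_degree t \<le> L" by (simp add: L_def)
      then show False using False t by (simp add: B_def)
    qed
    then show ?thesis by (simp add: lookup_sum lookup_mvconst_times)
  qed
  have "?p A \<in> carrier (mvpoly_ring X)"
    using assms(2,3)
    by (intro mvpoly_ring_sum_closed mvpoly_ring_carrier_closed power_product_closed) (auto simp: A_def)
  then have "?p A \<in> nonface_polys X \<Delta>"
    using lk by (auto simp: nonface_polys_def in_keys_iff)
  moreover have "?p A = ?p {\<alpha> \<in> A. c \<alpha> \<noteq> 0}"
    using finA by (intro sum.mono_neutral_right) (auto simp: mvconst_def)
  ultimately have "?p {\<alpha> \<in> A. c \<alpha> \<noteq> 0} \<in> nonface_polys X \<Delta>" by simp
  moreover have "length \<alpha> = length as \<and> c \<alpha> \<noteq> 0" if "\<alpha> \<in> {\<alpha> \<in> A. c \<alpha> \<noteq> 0}" for \<alpha>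
    using that assms(2) by (simp add: A_def)
  moreover have "finite {\<alpha> \<in> A. c \<alpha> \<noteq> 0}" "{\<alpha> \<in> A. c \<alpha> \<noteq> 0} \<noteq> {}"
    using finA c(1) by (simp, blast)
  ultimately show ?thesis by (intro that)
qed

lemma face_ring_chain_le:
  fixes P :: "nat \<Rightarrow> ('x, 'k::field) mvpoly set set"
  assumes "\<And>F. F \<in> \<Delta> \<Longrightarrow> card F \<le> d"
    and "\<And>i. i \<le> r \<Longrightarrow> primeideal (P i) face_ring" "\<And>i. i < r \<Longrightarrow> P i \<subset> P (Suc i)"
  shows "r \<le> d"
proof (rule ccontr)
  assume "\<not> r \<le> d"
  then have r: "Suc d \<le> r" by simp
  \<comment> \<open>The chain is pulled back to the polynomial ring; it stays strict because the
    quotient map is surjective.\<close>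
  define Q where "Q = (\<lambda>i. {p \<in> carrier (mvpoly_ring X). face_coset p \<in> P i})"
  interpret h: ring_hom_ring "mvpoly_ring X" "face_ring :: ('x, 'k) mvpoly set ring" face_coset
    by (rule face_coset_hom)
  have prime: "primeideal (Q i) (mvpoly_ring X)" if "i \<le> r" for i
    unfolding Q_def by (rule h.primeideal_vimage[OF cring_mvpoly_ring assms(2)[OF that]])
  have "\<exists>a. a \<in> Q (Suc i) - Q i" if i: "i < r" for i
  proof -
    obtain u where u: "u \<in> P (Suc i)" "u \<notin> P i" using assms(3)[OF i] by blast
    interpret P: primeideal "P (Suc i)" face_ring using assms(2) i by simp
    obtain p where "p \<in> carrier (mvpoly_ring X)" "u = face_coset p"
      using face_coset_surj[OF P.Icarr[OF u(1)]] .
    then show ?thesis using u unfolding Q_def by blast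
  qed
  then obtain a where a: "\<And>i. i < r \<Longrightarrow> a i \<in> Q (Suc i) - Q i" by metis
  let ?as = "map a [0..<Suc d]"
  have len: "length ?as = Suc d" by simp
  have "set ?as \<subseteq> carrier (mvpoly_ring X)" using a r by (auto simp: Q_def simp del: upt_Suc)
  then obtain A c where A: "finite A" "A \<noteq> {}" "\<And>\<alpha>. \<alpha> \<in> A \<Longrightarrow> length \<alpha> = length ?as \<and> c \<alpha> \<noteq> 0"
    "(\<Sum>\<alpha>\<in>A. mvconst (c \<alpha>) * power_product ?as \<alpha>) \<in> nonface_polys X \<Delta>"
    using face_ring_dependent[OF assms(1) len] by blast
  have "nonface_polys X \<Delta> \<subseteq> Q 0"
  proof
    fix p :: "('x, 'k) mvpoly" assume p: "p \<in> nonface_polys X \<Delta>"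
    then have pc: "p \<in> carrier (mvpoly_ring X)" by (simp add: nonface_polys_def)
    have "face_coset p = face_coset 0"
      using p by (subst nonface_coset_eq_iff[OF pc mvpoly_ring_carrier_closed(1)])
        (auto simp: nonface_polys_def in_keys_iff)
    moreover interpret P: primeideal "P 0" face_ring using assms(2) by simp
    have "face_coset 0 \<in> P 0" using P.zero_closed h.hom_zero by simp
    ultimately show "p \<in> Q 0" using pc by (simp add: Q_def)
  qed
  moreover have "(\<Sum>\<alpha>\<in>A. mvconst (c \<alpha>) * power_product ?as \<alpha>) \<notin> Q 0"
  proof (rule prime_chain_independent[OF _ _ _ A(1-3)])
    show "primeideal (Q i) (mvpoly_ring X)" if "i \<le> length ?as" for i using prime that r by simp
    show "Q i \<subseteq> Q (Suc i)" if "i < length ?as" for i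
      using assms(3)[of i] that r by (auto simp: Q_def)
    show "?as ! i \<in> Q (Suc i) - Q i" if "i < length ?as" for i
      using a[of i] that r by (simp del: upt_Suc)
  qed
  ultimately show False using A(4) by blast
qed

text \<open>Because \<open>Q\<close> contains the ideal, membership of a class can be tested on any
  representative; primality and strict inclusions thus pass to the quotient.\<close>

lemma primeideal_face_coset_image:
  fixes Q :: "('x, 'k::field) mvpoly set"
  assumes "primeideal Q (mvpoly_ring X)" "nonface_polys X \<Delta> \<subseteq> Q"
  shows "primeideal (face_coset ` Q) face_ring"
    and "p \<in> carrier (mvpoly_ring X) \<Longrightarrow> face_coset p \<in> face_coset ` Q \<longleftrightarrow> p \<in> Q"
proof -
  interpret Q: primeideal Q "mvpoly_ring X" by (rule assms(1))
  interpret h: ring_hom_ring "mvpoly_ring X" "face_ring :: ('x, 'k) mvpoly set ring" face_coset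
    by (rule face_coset_hom)
  have iff: "face_coset p \<in> face_coset ` Q \<longleftrightarrow> p \<in> Q" if p: "p \<in> carrier (mvpoly_ring X)" for p
  proof
    assume "face_coset p \<in> face_coset ` Q"
    then obtain q where q: "q \<in> Q" "face_coset p = face_coset q" by blast
    then have "p \<ominus>\<^bsub>mvpoly_ring X\<^esub> q \<in> nonface_polys X \<Delta>"
      using ring.quotient_eq_iff_same_a_r_cos[OF ring_mvpoly_ring ideal_nonface p Q.Icarr[OF q(1)]]
      by simp
    then have "p - q \<in> Q" using assms(2) mvpoly_ring_minus[OF p Q.Icarr[OF q(1)]] by auto
    from additive_subgroup.a_closed[OF Q.additive_subgroup_axioms this q(1)] show "p \<in> Q" by simp
  qed blast
  then show "p \<in> carrier (mvpoly_ring X) \<Longrightarrow> face_coset p \<in> face_coset ` Q \<longleftrightarrow> p \<in> Q" .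
  show "primeideal (face_coset ` Q) face_ring"
  proof (rule primeidealI)
    show "ideal (face_coset ` Q) face_ring"
      by (rule ring.ring_ideal_imp_quot_ideal[OF ring_mvpoly_ring ideal_nonface Q.ideal_axioms])
    show "cring (face_ring :: ('x, 'k) mvpoly set ring)"
      by (rule ideal.quotient_is_cring[OF ideal_nonface cring_mvpoly_ring])
    have "1 \<notin> Q" using Q.one_imp_carrier Q.I_notcarr by auto
    then have "face_coset 1 \<notin> face_coset ` Q" using iff mvpoly_ring_carrier_closed(2) by blast
    then show "carrier face_ring \<noteq> face_coset ` Q"
      using face_coset_arith(3)[OF mvpoly_ring_carrier_closed(2) mvpoly_ring_carrier_closed(2)] by blast
    fix u v assume uv: "u \<in> carrier face_ring" "v \<in> carrier face_ring"
      "u \<otimes>\<^bsub>face_ring\<^esub> v \<in> face_coset ` Q"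
    obtain p where p: "p \<in> carrier (mvpoly_ring X)" "u = face_coset p"
      using face_coset_surj[OF uv(1)] .
    obtain q where q: "q \<in> carrier (mvpoly_ring X)" "v = face_coset q"
      using face_coset_surj[OF uv(2)] .
    have "face_coset (p * q) \<in> face_coset ` Q" using uv(3) face_coset_arith(2)[OF p(1) q(1)] p q by simp
    then have "p * q \<in> Q" using iff mvpoly_ring_carrier_closed(5)[OF p(1) q(1)] by blast
    then have "p \<in> Q \<or> q \<in> Q" using Q.I_prime[OF p(1) q(1)] by simp
    then show "u \<in> face_coset ` Q \<or> v \<in> face_coset ` Q" using p q by blast
  qed
qed

lemma face_ring_chain_exists:
  assumes "F \<in> \<Delta>" "card F = d"
  shows "\<exists>P :: nat \<Rightarrow> ('x, 'k::field) mvpoly set set.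
    (\<forall>i\<le>d. primeideal (P i) face_ring) \<and> (\<forall>i<d. P i \<subset> P (Suc i))"
proof -
  obtain xs where xs: "set xs = F" "distinct xs"
    using finite_distinct_list[OF finite_face[OF assms(1)]] by blast
  then have len: "length xs = d" using assms(2) distinct_card by fastforce
  \<comment> \<open>Listing the face in some order, \<open>drop i xs\<close> supplies its shrinking
    subsets, from the whole face at 0 to the empty set at \<open>d\<close>.\<close>
  define Q :: "nat \<Rightarrow> ('x, 'k) mvpoly set" where "Q = (\<lambda>i. nonface_polys X (Pow (set (drop i xs))))"
  have prime: "primeideal (Q i) (mvpoly_ring X)" for i
    unfolding Q_def by (rule primeideal_nonface_polys_Pow) simp
  have "Pow (set (drop i xs)) \<subseteq> \<Delta>" for i
    using face_down[OF assms(1)] set_drop_subset[of i xs] xs(1) by blast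
  then have sub: "nonface_polys X \<Delta> \<subseteq> Q i" for i unfolding Q_def nonface_polys_def by blast
  have strict: "face_coset ` Q i \<subset> face_coset ` Q (Suc i)" if i: "i < d" for i
  proof -
    have dr: "drop i xs = xs ! i # drop (Suc i) xs" using i len by (simp add: Cons_nth_drop_Suc)
    have "set (drop (Suc i) xs) \<subseteq> set (drop i xs)" unfolding dr by auto
    then have "Q i \<subseteq> Q (Suc i)" unfolding Q_def nonface_polys_def by blast
    moreover have "xs ! i \<in> X" using i len xs(1) face_subset[OF assms(1)] nth_mem by blast
    then have mc: "mvvar (xs ! i) \<in> carrier (mvpoly_ring X :: ('x, 'k) mvpoly ring)"
      by (simp add: mvpoly_ring_carrier_iff mvvar_def)
    \<comment> \<open>Distinctness keeps \<open>xs ! i\<close> out of the rest of the list, so its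
      variable enters the ideal exactly at this stage.\<close>
    have "distinct (drop i xs)" using xs(2) by simp
    then have "mvvar (xs ! i) \<in> Q (Suc i)" "mvvar (xs ! i) \<notin> Q i"
      using mc unfolding dr Q_def nonface_polys_def by (auto simp: mvvar_def dr)
    then have "face_coset (mvvar (xs ! i)) \<in> face_coset ` Q (Suc i)"
      "face_coset (mvvar (xs ! i)) \<notin> face_coset ` Q i"
      using primeideal_face_coset_image(2)[OF prime sub mc] by blast+
    ultimately show ?thesis by blast
  qed
  have "primeideal (face_coset ` Q i) face_ring" for i
    by (rule primeideal_face_coset_image(1)[OF prime sub])
  then show ?thesis using strict by (intro exI[of _ "\<lambda>i. face_coset ` Q i"]) blast
qed

lemma krull_dim_stanley_reisner_ring:
  assumes "\<And>F. F \<in> \<Delta> \<Longrightarrow> card F \<le> d" "F \<in> \<Delta>" "card F = d"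
  shows "krull_dim (stanley_reisner_ring X \<Delta> :: ('x, 'k::field) mvpoly set ring) = enat d"
proof -
  let ?A = "face_ring :: ('x, 'k) mvpoly set ring"
  let ?C = "{enat r | r. \<exists>P. (\<forall>i\<le>r. primeideal (P i) ?A) \<and> (\<forall>i<r. P i \<subset> P (Suc i))}"
  have "Sup ?C \<le> enat d"
  proof (rule Sup_least)
    fix z assume "z \<in> ?C"
    then obtain r P where "z = enat r" "\<forall>i\<le>r. primeideal (P i) ?A" "\<forall>i<r. P i \<subset> P (Suc i)"
      by blast
    then show "z \<le> enat d" using face_ring_chain_le[OF assms(1), of r P] by simp
  qed
  moreover have "enat d \<le> Sup ?C"
    by (rule Sup_upper) (use face_ring_chain_exists[OF assms(2,3)] in blast)
  ultimately show ?thesis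
    by (simp add: krull_dim_def stanley_reisner_ring_def stanley_reisner_ideal_eq)
qed

text \<open>The Krull dimension fixes the exponent of 1 - X, so the equation for the Hilbert series
  leaves a single candidate for the description in \<open>h_polynomial\<close>.\<close>

lemma stanley_reisner_h_vector_eq:
  assumes "\<And>F. F \<in> \<Delta> \<Longrightarrow> card F \<le> d" "F \<in> \<Delta>" "card F = d"
  shows "stanley_reisner_h_vector TYPE('k::field) X \<Delta> k = Polynomial.coeff (face_h_poly d) k"
proof -
  let ?A = "stanley_reisner_ring X \<Delta> :: ('x, 'k) mvpoly set ring"
  let ?H = "hilbert_series ?A (stanley_reisner_scalars X \<Delta>) (stanley_reisner_component X \<Delta>)"
  have "?H = Abs_fps (\<lambda>i. int (card (face_monomials i)))"
    by (simp add: hilbert_series_def stanley_reisner_hilbert_function)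
  then have H: "?H * (1 - fps_X) ^ d = fps_of_poly (face_h_poly d)"
    using face_monomials_series[OF assms(1)] by simp
  have dim: "krull_dim ?A = enat d" using krull_dim_stanley_reisner_ring[OF assms] .
  have "h_polynomial ?A (stanley_reisner_scalars X \<Delta>) (stanley_reisner_component X \<Delta>) = face_h_poly d"
    unfolding h_polynomial_def
  proof (rule the_equality)
    show "poly (face_h_poly d) 1 \<noteq> 0 \<and>
        (\<exists>d'. krull_dim ?A = enat d' \<and> ?H * (1 - fps_X) ^ d' = fps_of_poly (face_h_poly d))"
      using dim H poly_face_h_poly_1[OF assms(2,3,1)] by blast
    fix h assume "poly h 1 \<noteq> 0 \<and> (\<exists>d'. krull_dim ?A = enat d' \<and> ?H * (1 - fps_X) ^ d' = fps_of_poly h)"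
    then have "fps_of_poly h = fps_of_poly (face_h_poly d)" using dim H by auto
    then show "h = face_h_poly d" by simp
  qed
  then show ?thesis by (simp add: stanley_reisner_h_vector_def h_vector_def)
qed

end

section \<open>The h-vector of the spanning complex\<close>

text \<open>Removing \<open>C\<close> is a bijection onto the subsets of \<open>E - C\<close> with
  \<open>i - card C\<close> elements. For \<open>i < card C\<close> both sides vanish, the right one
  by the negative lower index.\<close>

lemma card_subsets_containing:
  assumes "finite E" "C \<subseteq> E"
  shows "int (card {F. F \<subseteq> E \<and> C \<subseteq> F \<and> card F = i}) = binom (card E - card C) (int i - int (card C))"
proof (cases "card C \<le> i")
  case True
  have finC: "finite C" using assms finite_subset by blast
  have "bij_betw (\<lambda>H. H \<union> C) {H. H \<subseteq> E - C \<and> card H = i - card C} {F. F \<subseteq> E \<and> C \<subseteq> F \<and> card F = i}"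
  proof (rule bij_betw_byWitness[where f' = "\<lambda>F. F - C"])
    show "(\<lambda>H. H \<union> C) ` {H. H \<subseteq> E - C \<and> card H = i - card C} \<subseteq> {F. F \<subseteq> E \<and> C \<subseteq> F \<and> card F = i}"
    proof clarify
      fix H assume H: "H \<subseteq> E - C" "card H = i - card C"
      then have "finite H" using assms(1) finite_subset by blast
      then have "card (H \<union> C) = i" using H finC True by (subst card_Un_disjoint) auto
      then show "H \<union> C \<subseteq> E \<and> C \<subseteq> H \<union> C \<and> card (H \<union> C) = i" using H assms(2) by blast
    qed
    show "(\<lambda>F. F - C) ` {F. F \<subseteq> E \<and> C \<subseteq> F \<and> card F = i} \<subseteq> {H. H \<subseteq> E - C \<and> card H = i - card C}"
      using finC by (auto simp: card_Diff_subset)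
  qed auto
  then have "card {F. F \<subseteq> E \<and> C \<subseteq> F \<and> card F = i} = card {H. H \<subseteq> E - C \<and> card H = i - card C}"
    by (simp add: bij_betw_same_card)
  also have "\<dots> = (card E - card C) choose (i - card C)"
    using assms finC by (simp add: n_subsets card_Diff_subset)
  finally show ?thesis using True by (simp add: binom_def nat_diff_distrib)
next
  case False
  then have "{F. F \<subseteq> E \<and> C \<subseteq> F \<and> card F = i} = {}"
    using assms(1) card_mono finite_subset by (metis (mono_tags, lifting) Collect_empty_eq)
  then have "card {F. F \<subseteq> E \<and> C \<subseteq> F \<and> card F = i} = 0" by (simp only: card.empty)
  then show ?thesis using False by (simp add: binom_def)
qed

lemma card_subsets_not_containing:
  assumes "finite E" "C \<subseteq> E"
  shows "int (card {F \<in> {F. F \<subseteq> E \<and> \<not> C \<subseteq> F}. card F = i}) =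
    int (card E choose i) - binom (card E - card C) (int i - int (card C))"
proof -
  let ?A = "{F. F \<subseteq> E \<and> card F = i}" and ?B = "{F. F \<subseteq> E \<and> C \<subseteq> F \<and> card F = i}"
  have fin: "finite ?A" using assms(1) by simp
  have sub: "?B \<subseteq> ?A" by blast
  have "{F \<in> {F. F \<subseteq> E \<and> \<not> C \<subseteq> F}. card F = i} = ?A - ?B" by blast
  then have "int (card {F \<in> {F. F \<subseteq> E \<and> \<not> C \<subseteq> F}. card F = i}) = int (card ?A) - int (card ?B)"
    using card_Diff_subset[OF finite_subset[OF sub fin] sub] card_mono[OF fin sub] by simp
  then show ?thesis using card_subsets_containing[OF assms] n_subsets[OF assms(1)] by simp
qed

theorem theorem3p5:
  fixes V :: "'v set" and E :: "'v set set" and n m :: nat and h :: "nat \<Rightarrow> int"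
  assumes "unicyclic_graph n m V E"
    and "m \<le> n"
    and "h = stanley_reisner_h_vector TYPE('k::field) E (spanning_complex V E)"
  shows "(\<forall>k. k > n - 1 \<longrightarrow> h k = 0) \<and>
    (\<forall>k. k \<le> m - 1 \<longrightarrow>
       h k = (\<Sum>i=0..k. (-1) ^ (k - i) * int ((n - 1 - i) choose (k - i)) * int (n choose i))) \<and>
    (\<forall>k. m - 1 < k \<and> k \<le> n - 1 \<longrightarrow>
       h k = (\<Sum>i=0..k. (-1) ^ (k - i) * int ((n - 1 - i) choose (k - i)) *
                (int (n choose i) - binom (n - m) (int i - int m))))"
proof -
  have G: "simple_graph V E" "connected_graph V E" "card V = n"
    using assms(1) unfolding unicyclic_graph_def by blast+
  obtain C where C: "graph_cycles E = {C}" "card C = m"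
    using assms(1) unfolding unicyclic_graph_def by (elim conjE exE)
  note U = unicyclic_spanning_complex[OF G(1,2) C(1)]
  have finE: "finite E" using G(1) finite_subset[of E "Pow V"] unfolding simple_graph_def by blast
  have cardE: "card E = n" using U(3) G(3) by simp
  \<comment> \<open>Ensures that \<open>m - 1\<close> does not truncate, so that
    \<open>k \<le> m - 1\<close> means \<open>k < m\<close>.\<close>
  have m: "m \<ge> 1" using U(1,2) C(2) finite_subset[OF U(1) finE] by (simp add: Suc_le_eq card_gt_0_iff flip: C(2))
  interpret simplicial_complex E "spanning_complex V E"
    using finE U(2) unfolding U(4) by unfold_locales blast+
  \<comment> \<open>A face misses an edge of \<open>C\<close>, hence is a proper subset of
    \<open>E\<close>; the next step shows that \<open>n - 1\<close> is attained.\<close>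
  have le: "card F \<le> n - 1" if "F \<in> spanning_complex V E" for F
  proof -
    have "F \<subset> E" using that U(1) unfolding U(4) by blast
    from psubset_card_mono[OF finE this] show ?thesis using cardE by simp
  qed
  obtain e where e: "e \<in> C" using U(2) by blast
  then have "E - {e} \<in> spanning_complex V E" "card (E - {e}) = n - 1"
    using U(1) cardE finE unfolding U(4) by (blast, simp add: subset_eq)
  then have h: "h k = Polynomial.coeff (face_h_poly (n - 1)) k" for k
    unfolding assms(3) using le by (intro stanley_reisner_h_vector_eq)
  have "int (card {F \<in> spanning_complex V E. card F = i}) =
      int (n choose i) - binom (n - m) (int i - int m)" for i
    using card_subsets_not_containing[OF finE U(1), of i] by (simp only: U(4) cardE C(2))
  then have hk: "h k = (\<Sum>i=0..k. (-1) ^ (k - i) * int ((n - 1 - i) choose (k - i)) *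
      (int (n choose i) - binom (n - m) (int i - int m)))" for k
    by (simp only: h coeff_face_h_poly[of "n - 1", OF le])
  moreover have "h k = 0" if "k > n - 1" for k
    unfolding h using coeff_face_h_poly_eq_0[OF le that] .
  \<comment> \<open>For \<open>i \<le> k < m\<close> the lower index \<open>int i - int m\<close> is
    negative, so the correction in the general formula \<open>hk\<close> vanishes.\<close>
  moreover have "h k = (\<Sum>i=0..k. (-1) ^ (k - i) * int ((n - 1 - i) choose (k - i)) * int (n choose i))"
    if "k \<le> m - 1" for k
    unfolding hk by (rule sum.cong) (use that m in \<open>auto simp: binom_def\<close>)
  ultimately show ?thesis by blast
qed

end
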